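(* Let $r\geq 1$ be an integer. The principal square root function $\varphi: Q\in \mathcal{S}_r^+\mapsto \varphi(Q)=Q^{1/2}\in \mathcal{S}_r^+$ is Fréchet differentiable at any order on $\mathcal{S}_r^+$. For any $(A,H)\in \mathcal{S}_r^+\times\mathcal{S}_r$ its first order derivative is given by $$\nabla\varphi(A)\cdot H=\int_0^\infty e^{-t\varphi(A)}\,H\,e^{-t\varphi(A)}\,dt,$$ and its higher order derivatives are given inductively, for any $n\geq 2$, by $$\nabla^n\varphi(A)\cdot H=-\nabla\varphi(A)\cdot\left[\sum_{p+q=n-2}\frac{n!}{(p+1)!\,(q+1)!}\,\left[\nabla^{p+1}\varphi(A)\cdot H\right]\left[\nabla^{q+1}\varphi(A)\cdot H\right]\right],$$ where the sum is over all integers $p,q\geq 0$ such that $p+q=n-2$. Moreover, let $A\in\mathcal{S}_r^+$ and $H\in\mathcal{S}_r$ be such that $A+H\in\mathcal{S}_r^+$. Then $\varphi$ has a Taylor expansion at any order: for every integer $n\geq 0$, $$\varphi(A+H)=\varphi(A)+\sum_{1\leq k\leq n}\frac{1}{k!}\,\nabla^k\varphi(A)\cdot H+\overline{\nabla}^{n+1}\varphi[A,H],$$ where $$\overline{\nabla}^{n+1}\varphi[A,H]:=\frac{1}{n!}\int_0^1(1-\epsilon)^n\,\nabla^{n+1}\varphi(A+\epsilon H)\cdot H\,d\epsilon.$$ In addition, for any $n\geq 0$, $$\left|\left|\left|\nabla^{n+1}\varphi(A)\right|\right|\right|\leq K^n\,(n+1)!\,C_n\,2^{-(2n+1)}\,\lambda_{\min}(A)^{-(n+1/2)},$$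 $$\left\Vert\overline{\nabla}^{n+1}\varphi[A,H]\right\Vert\leq K^n\,(n+1)\,C_n\,2^{-2n}\,\lambda_{\min}(A)^{-(n+1/2)}\,\Vert H\Vert^{n+1},$$ where $C_n=\frac{1}{n+1}\binom{2n}{n}$ is the $n$-th Catalan number, $K=\sqrt{r}$ when $\Vert\cdot\Vert$ is the Frobenius norm, and $K=1$ when $\Vert\cdot\Vert$ is the $\mathbb{L}_2$-norm.
   Context: $\mathcal{S}_r$ is the space of symmetric $(r\times r)$-matrices with real entries, equipped with a norm $\Vert\cdot\Vert$ that is either the $\mathbb{L}_2$-norm (spectral norm) $\Vert A\Vert_2=\sqrt{\lambda_{\max}(A^2)}$ or the Frobenius norm $\Vert A\Vert_F=\sqrt{\mathrm{Tr}(A^2)}$. $\mathcal{S}_r^+\subset\mathcal{S}_r$ is the open convex subset of positive definite matrices. $\lambda_{\min}(A)$ and $\lambda_{\max}(A)$ denote the smallest and largest eigenvalues of $A\in\mathcal{S}_r$. For $Q\in\mathcal{S}_r^+$, $Q^{1/2}$ is the unique positive definite square root of $Q$. Fréchet derivatives. Let $\mathcal{O}_r\subset\mathcal{S}_r$ be a nonempty open convex set. A map $\Upsilon:\mathcal{O}_r\to\mathcal{S}_r$ is Fréchet differentiable at $A\in\mathcal{O}_r$ if there is a continuous linear map $\nabla\Upsilon(A):\mathcal{S}_r\to\mathcal{S}_r$ such that $\Vert H\Vert^{-1}\Vert\Upsilon(A+H)-\Upsilon(A)-\nabla\Upsilon(A)\cdot H\Vert\to 0$ as $\Vert H\Vert\to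 0$; it is Fréchet differentiable on $\mathcal{O}_r$ when moreover $A\in\mathcal{O}_r\mapsto\nabla\Upsilon(A)$ is continuous. Higher derivatives are defined recursively in the same manner (differentiating $\nabla^{n-1}\Upsilon$), and $\nabla^n\Upsilon(A)$ is identified with a continuous symmetric $n$-linear map from $\mathcal{S}_r^n$ to $\mathcal{S}_r$. Throughout, $\nabla^n\Upsilon(A)\cdot H$ is shorthand for $\nabla^n\Upsilon(A)\cdot(H,\ldots,H)$ ($n$ copies of $H$), i.e. the $n$-th derivative evaluated in the single direction $H$. The operator norm used is $$\left|\left|\left|\nabla^n\Upsilon(A)\right|\right|\right|=\sup_{\Vert H\Vert=1}\Vert\nabla^n\Upsilon(A)\cdot H\Vert,$$ with the same norm $\Vert\cdot\Vert$ (spectral or Frobenius) on both sides. *)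

theory Defs
  imports "HOL-Analysis.Analysis"
begin

section \<open>Symmetric and positive definite matrices\<close>

definition symmetric_matrices :: "(real^'r^'r) set" where
  "symmetric_matrices = {A. transpose A = A}"

definition posdef_matrices :: "(real^'r^'r) set" where
  "posdef_matrices = {A \<in> symmetric_matrices. \<forall>x. x \<noteq> 0 \<longrightarrow> x \<bullet> (A *v x) > 0}"

definition eigenvalues :: "real^'r^'r \<Rightarrow> real set" where
  "eigenvalues A = {l. \<exists>v. v \<noteq> 0 \<and> A *v v = l *\<^sub>R v}"

definition lambda_min :: "real^'r^'r \<Rightarrow> real" where
  "lambda_min A = Min (eigenvalues A)"

definition lambda_max :: "real^'r^'r \<Rightarrow> real" where
  "lambda_max A = Max (eigenvalues A)"

text \<open>Both norms are only meant to be applied to symmetric matrices.\<close>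

definition spectral_norm :: "real^'r^'r \<Rightarrow> real" where
  "spectral_norm A = sqrt (lambda_max (A ** A))"

definition frobenius_norm :: "real^'r^'r \<Rightarrow> real" where
  "frobenius_norm A = sqrt (trace (A ** A))"

definition principal_sqrt :: "real^'r^'r \<Rightarrow> real^'r^'r" where
  "principal_sqrt Q = (THE R. R \<in> posdef_matrices \<and> R ** R = Q)"

text \<open>
  The type of matrices is not an instance of the class on which \<^const>\<open>exp\<close> is defined
  (its multiplication \<open>*\<close> is componentwise), so the exponential series is written out.
\<close>

definition matrix_exp :: "real^'r^'r \<Rightarrow> real^'r^'r" where
  "matrix_exp A = (\<Sum>k. (1 / fact k) *\<^sub>R (((\<lambda>B. A ** B) ^^ k) (mat 1)))"

definition catalan :: "nat \<Rightarrow> real" where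
  "catalan n = real ((2 * n) choose n) / (real n + 1)"


section \<open>Iterated Frechet derivatives on the space of symmetric matrices\<close>

text \<open>
  An \<open>n\<close>-linear map on the space of symmetric matrices is represented by a function on lists,
  of which only the values on \<open>directions n\<close> are relevant. The parameter \<open>N\<close> is the norm with
  which the space of symmetric matrices is equipped.
\<close>

definition directions :: "nat \<Rightarrow> (real^'r^'r) list set" where
  "directions n = {Xs. set Xs \<subseteq> symmetric_matrices \<and> length Xs = n}"

definition bounded_multilinear ::
    "(real^'r^'r \<Rightarrow> real) \<Rightarrow> nat \<Rightarrow> ((real^'r^'r) list \<Rightarrow> real^'r^'r) \<Rightarrow> bool" where
  "bounded_multilinear N n T \<longleftrightarrow>
     (\<forall>Xs \<in> directions n. T Xs \<in> symmetric_matrices) \<and>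
     (\<forall>Xs \<in> directions n. \<forall>i < n. \<forall>Y \<in> symmetric_matrices. \<forall>Z \<in> symmetric_matrices. \<forall>a b.
        T (Xs[i := a *\<^sub>R Y + b *\<^sub>R Z]) = a *\<^sub>R T (Xs[i := Y]) + b *\<^sub>R T (Xs[i := Z])) \<and>
     (\<exists>B. \<forall>Xs \<in> directions n. N (T Xs) \<le> B * (\<Prod>X\<leftarrow>Xs. N X))"

text \<open>
  Let \<open>G\<close> map each point of \<open>U\<close> to an \<open>n\<close>-linear map. A linear map from symmetric matrices to
  \<open>n\<close>-linear maps is identified with an \<open>(n+1)\<close>-linear map \<open>L\<close>, the increment being the head of
  the list. The estimate says that the operator norm of the \<open>n\<close>-linear map
  \<open>G (A + H) - G A - L \<cdot> H\<close> is at most \<open>e * N H\<close>.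
\<close>

definition has_frechet_derivative_at ::
    "(real^'r^'r \<Rightarrow> real) \<Rightarrow> (real^'r^'r) set \<Rightarrow> nat \<Rightarrow>
     (real^'r^'r \<Rightarrow> (real^'r^'r) list \<Rightarrow> real^'r^'r) \<Rightarrow> real^'r^'r \<Rightarrow>
     ((real^'r^'r) list \<Rightarrow> real^'r^'r) \<Rightarrow> bool" where
  "has_frechet_derivative_at N U n G A L \<longleftrightarrow>
     bounded_multilinear N (Suc n) L \<and>
     (\<forall>e>0. \<exists>d>0. \<forall>H \<in> symmetric_matrices. N H < d \<longrightarrow> A + H \<in> U \<longrightarrow>
        (\<forall>Xs \<in> directions n.
           N (G (A + H) Xs - G A Xs - L (H # Xs)) \<le> e * N H * (\<Prod>X\<leftarrow>Xs. N X)))"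

text \<open>
  The \<open>n\<close>-th derivative of \<open>F\<close>. For open \<open>U\<close> the derivative is unique on \<open>directions (Suc n)\<close>,
  so the choice is immaterial there.
\<close>

primrec nabla ::
    "(real^'r^'r \<Rightarrow> real) \<Rightarrow> (real^'r^'r) set \<Rightarrow> (real^'r^'r \<Rightarrow> real^'r^'r) \<Rightarrow> nat \<Rightarrow>
     real^'r^'r \<Rightarrow> (real^'r^'r) list \<Rightarrow> real^'r^'r" where
  "nabla N U F 0 = (\<lambda>A Xs. F A)"
| "nabla N U F (Suc n) = (\<lambda>A. SOME L. has_frechet_derivative_at N U n (nabla N U F n) A L)"

definition multilinear_continuous_on ::
    "(real^'r^'r \<Rightarrow> real) \<Rightarrow> (real^'r^'r) set \<Rightarrow> nat \<Rightarrow>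
     (real^'r^'r \<Rightarrow> (real^'r^'r) list \<Rightarrow> real^'r^'r) \<Rightarrow> bool" where
  "multilinear_continuous_on N U n G \<longleftrightarrow>
     (\<forall>A \<in> U. \<forall>e>0. \<exists>d>0. \<forall>B \<in> U. N (B - A) < d \<longrightarrow>
        (\<forall>Xs \<in> directions n. N (G B Xs - G A Xs) \<le> e * (\<Prod>X\<leftarrow>Xs. N X)))"

definition frechet_differentiable_any_order_on ::
    "(real^'r^'r \<Rightarrow> real) \<Rightarrow> (real^'r^'r) set \<Rightarrow> (real^'r^'r \<Rightarrow> real^'r^'r) \<Rightarrow> bool" where
  "frechet_differentiable_any_order_on N U F \<longleftrightarrow>
     (\<forall>n. (\<forall>A \<in> U. \<exists>L. has_frechet_derivative_at N U n (nabla N U F n) A L) \<and>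
          multilinear_continuous_on N U (Suc n) (nabla N U F (Suc n)))"

definition nabla_dir ::
    "(real^'r^'r \<Rightarrow> real) \<Rightarrow> (real^'r^'r) set \<Rightarrow> (real^'r^'r \<Rightarrow> real^'r^'r) \<Rightarrow> nat \<Rightarrow>
     real^'r^'r \<Rightarrow> real^'r^'r \<Rightarrow> real^'r^'r" where
  "nabla_dir N U F n A H = nabla N U F n A (replicate n H)"

text \<open>The supremum is taken in the extended reals, so a finite bound on it is meaningful.\<close>

definition nabla_norm ::
    "(real^'r^'r \<Rightarrow> real) \<Rightarrow> (real^'r^'r) set \<Rightarrow> (real^'r^'r \<Rightarrow> real^'r^'r) \<Rightarrow> nat \<Rightarrow>
     real^'r^'r \<Rightarrow> ereal" where
  "nabla_norm N U F n A =
     (SUP H \<in> {H \<in> symmetric_matrices. N H = 1}. ereal (N (nabla_dir N U F n A H)))"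

text \<open>The remainder of the expansion of order \<open>n\<close>, which involves the derivative of order \<open>n+1\<close>.\<close>

definition taylor_remainder ::
    "(real^'r^'r \<Rightarrow> real) \<Rightarrow> (real^'r^'r) set \<Rightarrow> (real^'r^'r \<Rightarrow> real^'r^'r) \<Rightarrow> nat \<Rightarrow>
     real^'r^'r \<Rightarrow> real^'r^'r \<Rightarrow> real^'r^'r" where
  "taylor_remainder N U F n A H =
     (1 / fact n) *\<^sub>R
       integral {0..1} (\<lambda>\<epsilon>. (1 - \<epsilon>) ^ n *\<^sub>R nabla_dir N U F (n + 1) (A + \<epsilon> *\<^sub>R H) H)"

end

theory Submission
  imports Defs
begin

text \<open>
  The square root \<open>\<phi>\<close> inverts the map \<open>R \<mapsto> R ** R\<close>, so everything comes from differentiating the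
  identity \<open>\<phi> A ** \<phi> A = A\<close>. In a direction \<open>H\<close> this gives \<open>\<phi> A ** X + X ** \<phi> A = H\<close> for the derivative
  \<open>X\<close>, a Sylvester equation. As \<open>\<phi> A\<close> is positive definite, its operator is coercive
  (\<open>sylvester_inner_lower_bound\<close>): the solution is unique, it is given by the integral of
  \<open>exp (- t \<phi> A) H exp (- t \<phi> A)\<close> (\<open>sylvester_integral\<close>, computed in an eigenbasis), and its norm is at most
  \<open>norm H / (2 * sqrt (lambda_min A))\<close>.

  For several directions \<open>Xs\<close> the Leibniz rule gives again a Sylvester equation with the same operator,
  whose right-hand side is minus the sum, over the splittings of \<open>Xs\<close> into two nonempty parts, of the products
  of the lower derivatives in these directions. This recursion is taken as the definition of
  \<open>sqrt_derivative A Xs\<close>. The solution of a Sylvester equation with differentiable data is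
  differentiable (\<open>sylvester_solution_has_derivative\<close>), and induction on the number of directions
  shows that the derivative of \<open>A \<mapsto> sqrt_derivative A Xs\<close> is \<open>H \<mapsto> sqrt_derivative A (H # Xs)\<close>.
  Since all these maps are multilinear in finitely many dimensions, derivatives for fixed directions are
  uniform in the directions (\<open>multilinear_tendsto_uniform\<close>). Thus \<open>sqrt_derivative\<close> is an iterated
  Frechet derivative, and by uniqueness it is the one selected by \<open>nabla\<close>
  (\<open>nabla_principal_sqrt\<close>).

  In a single direction the splittings are counted by binomial coefficients. Dividing the \<open>n\<close>-th derivative by
  \<open>n!\<close> turns the recursion, together with the bound for the Sylvester equation, into the Catalan recurrence
  (\<open>catalan_convolution\<close>, \<open>M_sqrt_derivative_le\<close>). The remainder of the Taylor formula is
  estimated along the segment from \<open>A\<close> to \<open>A + H\<close>, where the smallest eigenvalue is at least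
  \<open>(1 - t) * lambda_min A\<close>; the weight of the remainder cancels all of this degeneration but
  \<open>1 / sqrt (1 - t)\<close>, whose integral is \<open>2\<close>. Both the spectral and the Frobenius norm are submultiplicative, so
  these estimates hold with the constant \<open>1\<close>, hence with every \<open>K \<ge> 1\<close>.
\<close>

section \<open>Matrix multiplication and the Frobenius norm\<close>

lemma bounded_bilinear_matrix_mult:
  "bounded_bilinear ((**) :: real^'r^'r \<Rightarrow> real^'r^'r \<Rightarrow> real^'r^'r)"
  unfolding bilinear_conv_bounded_bilinear[symmetric] bilinear_def
  by (auto intro!: linearI simp: matrix_matrix_mult_def vec_eq_iff sum.distrib sum_distrib_left
      algebra_simps)

lemma bounded_bilinear_matrix_vector_mult:
  "bounded_bilinear ((*v) :: real^'r^'r \<Rightarrow> real^'r \<Rightarrow> real^'r)"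
  unfolding bilinear_conv_bounded_bilinear[symmetric] bilinear_def
  by (auto intro!: linearI simp: matrix_vector_right_distrib matrix_vector_mult_add_rdistrib
      scaleR_matrix_vector_assoc matrix_scaleR_vector_ac)

interpretation matmul: bounded_bilinear "(**) :: real^'r^'r \<Rightarrow> real^'r^'r \<Rightarrow> real^'r^'r"
  by (rule bounded_bilinear_matrix_mult)

interpretation matvec: bounded_bilinear "(*v) :: real^'r^'r \<Rightarrow> real^'r \<Rightarrow> real^'r"
  by (rule bounded_bilinear_matrix_vector_mult)

lemma linear_transpose: "linear (transpose :: real^'n^'m \<Rightarrow> real^'m^'n)"
  by (rule linearI) (simp_all add: transpose_def vec_eq_iff)

lemma subspace_symmetric_matrices: "subspace (symmetric_matrices :: (real^'r^'r) set)"
  using linear_transpose[where 'n='r and 'm='r]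
  by (auto simp: subspace_def symmetric_matrices_def linear_add linear_scale linear_0)

lemma symmetric_inner:
  fixes A :: "real^'r^'r"
  assumes "A \<in> symmetric_matrices"
  shows "x \<bullet> (A *v y) = (A *v x) \<bullet> y"
proof -
  have "x v* A = A *v x"
    using assms by (metis (mono_tags) mem_Collect_eq symmetric_matrices_def transpose_matrix_vector)
  then show ?thesis by (metis dot_lmul_matrix)
qed

lemma norm_matrix_power2: "(norm (A::real^'n^'m))\<^sup>2 = (\<Sum>i\<in>UNIV. (norm (A$i))\<^sup>2)"
  by (simp add: power2_norm_eq_inner inner_vec_def)

lemma norm_transpose: "norm (transpose (A::real^'n^'m)) = norm A"
proof -
  have "(norm (transpose A))\<^sup>2 = (norm A)\<^sup>2"
    unfolding norm_matrix_power2
    by (simp add: power2_norm_eq_inner inner_vec_def transpose_def) (rule sum.swap)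
  then show ?thesis by simp
qed

lemma norm_matrix_vector_mult_le: "norm ((A::real^'n^'m) *v x) \<le> norm A * norm x"
proof -
  have "(norm (A *v x))\<^sup>2 = (\<Sum>i\<in>UNIV. (A$i \<bullet> x)\<^sup>2)"
    unfolding power2_norm_eq_inner inner_vec_def[of "A *v x"]
    by (simp add: matrix_vector_mul_component power2_eq_square)
  also have "\<dots> \<le> (\<Sum>i\<in>UNIV. (norm (A$i))\<^sup>2 * (norm x)\<^sup>2)"
    by (intro sum_mono) (simp add: power2_norm_eq_inner Cauchy_Schwarz_ineq)
  also have "\<dots> = (norm A * norm x)\<^sup>2"
    by (simp add: norm_matrix_power2 power_mult_distrib sum_distrib_right)
  finally show ?thesis
    by (simp add: power2_le_iff_abs_le)
qed

lemma norm_matrix_mult_le: "norm ((A::real^'n^'m) ** (B::real^'p^'n)) \<le> norm A * norm B"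
proof -
  have row: "(A ** B) $ i = transpose B *v (A $ i)" for i
    by (simp add: vec_eq_iff matrix_matrix_mult_def vector_matrix_mult_def mult.commute)
  have "(norm (A ** B))\<^sup>2 = (\<Sum>i\<in>UNIV. (norm (transpose B *v (A $ i)))\<^sup>2)"
    by (simp only: norm_matrix_power2 row)
  also have "\<dots> \<le> (\<Sum>i\<in>UNIV. (norm B * norm (A$i))\<^sup>2)"
    by (intro sum_mono power_mono)
      (use norm_matrix_vector_mult_le[of "transpose B"] in \<open>auto simp: norm_transpose\<close>)
  also have "\<dots> = (norm A * norm B)\<^sup>2"
    by (simp add: norm_matrix_power2 power_mult_distrib sum_distrib_right mult.commute)
  finally show ?thesis
    by (simp add: power2_le_iff_abs_le)
qed

section \<open>Lower bounds for quadratic forms\<close>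

text \<open>
  A lower bound \<open>m\<close> on the quadratic form says the same as \<open>lambda_min A \<ge> m\<close> for
  symmetric \<open>A\<close>, but it passes to perturbations, convex combinations and square roots
  without any mention of eigenvalues.
\<close>

definition coercive :: "real \<Rightarrow> real^'r^'r \<Rightarrow> bool" where
  "coercive m A \<longleftrightarrow> (\<forall>x. m * (x \<bullet> x) \<le> x \<bullet> (A *v x))"

lemma coercive_mono: "coercive m A \<Longrightarrow> n \<le> m \<Longrightarrow> coercive n A"
  unfolding coercive_def by (meson inner_ge_zero mult_right_mono order_trans)

lemma coercive_perturb:
  assumes "coercive m A"
  shows "coercive (m - norm (B - A)) B"
  unfolding coercive_def
proof
  fix x
  have "\<bar>x \<bullet> ((B - A) *v x)\<bar> \<le> norm x * (norm (B - A) * norm x)"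
    by (intro order_trans[OF Cauchy_Schwarz_ineq2] mult_left_mono norm_matrix_vector_mult_le) simp
  also have "\<dots> = norm (B - A) * (x \<bullet> x)"
    by (simp add: power2_norm_eq_inner[symmetric] power2_eq_square)
  finally have "x \<bullet> (A *v x) - norm (B - A) * (x \<bullet> x) \<le> x \<bullet> (B *v x)"
    by (simp add: matvec.diff_left inner_diff_right)
  then show "(m - norm (B - A)) * (x \<bullet> x) \<le> x \<bullet> (B *v x)"
    using assms[unfolded coercive_def, rule_format, of x] by (simp add: left_diff_distrib)
qed

lemma coercive_convex:
  assumes "coercive a A" "coercive b B" "0 \<le> s" "0 \<le> t"
  shows "coercive (s * a + t * b) (s *\<^sub>R A + t *\<^sub>R B)"
  unfolding coercive_def
proof
  fix x
  have "s * (a * (x \<bullet> x)) + t * (b * (x \<bullet> x)) \<le> s * (x \<bullet> (A *v x)) + t * (x \<bullet> (B *v x))"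
    using assms by (intro add_mono mult_left_mono) (auto simp: coercive_def)
  then show "(s * a + t * b) * (x \<bullet> x) \<le> x \<bullet> ((s *\<^sub>R A + t *\<^sub>R B) *v x)"
    by (simp add: matvec.add_left matvec.scaleR_left inner_add_right algebra_simps)
qed

section \<open>Energy estimate for the Sylvester equation\<close>

lemma inner_matrix_left_mult:
  "(X::real^'s^'r) \<bullet> (R ** X) = (\<Sum>j\<in>UNIV. column j X \<bullet> (R *v column j X))"
  by (simp add: inner_vec_def matrix_matrix_mult_def matrix_vector_mult_def column_def) (rule sum.swap)

lemma inner_matrix_right_mult:
  "(X::real^'s^'r) \<bullet> (X ** S) = (\<Sum>i\<in>UNIV. X$i \<bullet> (S *v X$i))"
proof -
  have "(X ** S) $ i = X$i v* S" for i
    by (simp add: vec_eq_iff matrix_matrix_mult_def vector_matrix_mult_def)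
  then show ?thesis
    by (simp add: inner_vec_def[of X] dot_lmul_matrix[symmetric] inner_commute)
qed

text \<open>
  In the Frobenius inner product of \<open>X\<close> with \<open>R ** X + X ** S\<close>, the matrix \<open>R\<close> acts on the
  columns of \<open>X\<close> and \<open>S\<close> acts on its rows, so both quadratic forms contribute their lower bound.
\<close>

lemma sylvester_inner_lower_bound:
  assumes "coercive a R" "coercive b S"
  shows "(a + b) * (X \<bullet> X) \<le> X \<bullet> (R ** X + X ** S)"
proof -
  have "a * (X \<bullet> X) = (\<Sum>j\<in>UNIV. a * (column j X \<bullet> column j X))"
    unfolding sum_distrib_left[symmetric]
    by (simp add: inner_vec_def column_def) (subst sum.swap, simp)
  also have "\<dots> \<le> X \<bullet> (R ** X)"
    unfolding inner_matrix_left_mult using assms(1) by (intro sum_mono) (simp add: coercive_def)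
  finally have 1: "a * (X \<bullet> X) \<le> X \<bullet> (R ** X)" .
  have "b * (X \<bullet> X) = (\<Sum>i\<in>UNIV. b * (X$i \<bullet> X$i))"
    by (simp add: sum_distrib_left[symmetric] inner_vec_def[of X])
  also have "\<dots> \<le> X \<bullet> (X ** S)"
    unfolding inner_matrix_right_mult using assms(2) by (intro sum_mono) (simp add: coercive_def)
  finally show ?thesis using 1 by (simp add: inner_add_right distrib_right)
qed

lemma sylvester_norm_bound:
  assumes "coercive a R" "coercive b S"
  shows "(a + b) * norm X \<le> norm (R ** X + X ** S)"
proof (cases "X = 0")
  case False
  have "(a + b) * norm X * norm X \<le> norm (R ** X + X ** S) * norm X"
    using order_trans[OF sylvester_inner_lower_bound[OF assms, of X] norm_cauchy_schwarz]
    by (simp add: power2_norm_eq_inner[symmetric] power2_eq_square mult_ac)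
  then show ?thesis using False by simp
qed simp

lemma sylvester_unique:
  fixes R S X Y :: "real^'r^'r"
  assumes "coercive a R" "coercive b S" "a + b > 0"
    and "R ** X + X ** S = R ** Y + Y ** S"
  shows "X = Y"
proof -
  have "R ** (X - Y) + (X - Y) ** S = 0"
    using assms(4) by (simp add: matmul.diff_left matmul.diff_right algebra_simps)
  then show ?thesis
    using sylvester_norm_bound[OF assms(1,2), of "X - Y"] assms(3)
    by (simp add: mult_le_0_iff)
qed

section \<open>Spectral decomposition of symmetric matrices\<close>

text \<open>
  The Rayleigh quotient attains its minimum on the unit sphere of an invariant subspace \<open>V\<close>, and
  stationarity makes the minimiser an eigenvector. The version for subspaces, rather than for the
  whole space, is what splits off one eigenvector after the other.
\<close>

lemma rayleigh_minimum:
  fixes A :: "real^'r^'r"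
  assumes sym: "A \<in> symmetric_matrices" and V: "subspace V" "V \<noteq> {0}"
    and inv: "\<And>x. x \<in> V \<Longrightarrow> A *v x \<in> V"
  obtains v l where "v \<in> V" "norm v = 1" "A *v v = l *\<^sub>R v"
    "\<And>x. x \<in> V \<Longrightarrow> l * (x \<bullet> x) \<le> x \<bullet> (A *v x)"
proof -
  let ?S = "V \<inter> sphere 0 1"
  obtain w where w: "w \<in> V" "w \<noteq> 0"
    using V subspace_0 by blast
  have "(1 / norm w) *\<^sub>R w \<in> ?S"
    using w V by (simp add: subspace_scale)
  then have ne: "?S \<noteq> {}" by blast
  have "compact ?S"
    by (intro closed_Int_compact closed_subspace V) simp
  moreover have "continuous_on ?S (\<lambda>x. x \<bullet> (A *v x))"
    by (intro continuous_intros)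
  ultimately obtain v where v: "v \<in> ?S" and min: "\<And>y. y \<in> ?S \<Longrightarrow> v \<bullet> (A *v v) \<le> y \<bullet> (A *v y)"
    using continuous_attains_inf ne by (metis (no_types, lifting))
  define l where "l = v \<bullet> (A *v v)"
  have vV: "v \<in> V" and v1: "v \<bullet> v = 1" using v by (auto simp: norm_eq_1)
  have low: "l * (x \<bullet> x) \<le> x \<bullet> (A *v x)" if "x \<in> V" for x
  proof (cases "x = 0")
    case False
    define c where "c = 1 / norm x"
    have "c *\<^sub>R x \<in> ?S" using that False V by (simp add: subspace_scale c_def)
    from min[OF this] have "l \<le> c * (c * (x \<bullet> (A *v x)))"
      by (simp add: l_def matvec.scaleR_right)
    moreover have "c * c = 1 / (x \<bullet> x)"
      by (simp add: c_def power2_norm_eq_inner[symmetric] power2_eq_square)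
    ultimately have "l \<le> (x \<bullet> (A *v x)) / (x \<bullet> x)"
      by (simp add: mult.assoc[symmetric])
    then show ?thesis using False by (simp add: pos_le_divide_eq)
  qed simp
  \<comment> \<open>first-order optimality of the minimiser in the direction of its own defect\<close>
  define u where "u = A *v v - l *\<^sub>R v"
  define c where "c = u \<bullet> (A *v u) - l * (u \<bullet> u)"
  have uV: "u \<in> V" unfolding u_def by (intro subspace_diff subspace_scale V vV inv)
  have c0: "c \<ge> 0" using low[OF uV] by (simp add: c_def)
  have "0 \<le> 2 * t * (u \<bullet> u) + t\<^sup>2 * c" for t
  proof -
    have "v + t *\<^sub>R u \<in> V" by (intro subspace_add subspace_scale V vV uV)
    from low[OF this] have "0 \<le> (v + t *\<^sub>R u) \<bullet> (A *v (v + t *\<^sub>R u)) - l * ((v + t *\<^sub>R u) \<bullet> (v + t *\<^sub>R u))"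
      by simp
    also have "\<dots> = (v \<bullet> (A *v v) - l * (v \<bullet> v)) + 2 * t * (u \<bullet> (A *v v) - l * (u \<bullet> v)) + t\<^sup>2 * c"
      using symmetric_inner[OF sym, of v u]
      by (simp add: c_def matvec.add_right matvec.scaleR_right inner_add_left inner_add_right
          power2_eq_square inner_commute algebra_simps)
    also have "u \<bullet> (A *v v) - l * (u \<bullet> v) = u \<bullet> u"
      by (simp add: u_def inner_diff_right)
    finally show ?thesis by (simp add: l_def v1)
  qed
  \<comment> \<open>\<open>c + 1\<close> instead of the optimal \<open>c\<close>, which may be zero\<close>
  from this[of "- (u \<bullet> u) / (c + 1)"]
  have "0 \<le> 2 * (- (u \<bullet> u) / (c + 1)) * (u \<bullet> u) + (- (u \<bullet> u) / (c + 1))\<^sup>2 * c" .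
  also have "\<dots> = - ((u \<bullet> u)\<^sup>2 * ((c + 2) / (c + 1)\<^sup>2))"
  proof -
    have "2 * (- a / d) * a + (- a / d)\<^sup>2 * (d - 1) = - (a\<^sup>2 * ((d + 1) / d\<^sup>2))" if "d > 0" for a d :: real
      using that by (simp add: field_simps power2_eq_square)
    from this[of "c + 1" "u \<bullet> u"] c0 show ?thesis by simp
  qed
  finally have "(u \<bullet> u)\<^sup>2 * ((c + 2) / (c + 1)\<^sup>2) \<le> 0" by simp
  moreover have "(c + 2) / (c + 1)\<^sup>2 > 0" using c0 by simp
  ultimately have "(u \<bullet> u)\<^sup>2 \<le> 0"
    by (meson linorder_not_le mult_pos_pos)
  then have "A *v v = l *\<^sub>R v" by (simp add: u_def)
  with v low show ?thesis using that[of v l] by auto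
qed

lemma eigenvectors_orthogonal:
  assumes "A \<in> symmetric_matrices" "A *v v = a *\<^sub>R v" "A *v w = b *\<^sub>R w" "a \<noteq> b"
  shows "v \<bullet> w = 0"
proof -
  have "b * (v \<bullet> w) = a * (v \<bullet> w)"
    using symmetric_inner[OF assms(1), of v w] assms(2,3) by simp
  then show ?thesis using assms(4) by simp
qed

text \<open>
  Eigenvectors for distinct eigenvalues are orthogonal, hence linearly independent. Finiteness gives
  \<open>Min\<close> and \<open>Max\<close> of the spectrum their meaning.
\<close>

lemma finite_eigenvalues:
  assumes "A \<in> symmetric_matrices"
  shows "finite (eigenvalues A)"
proof -
  have "\<forall>l\<in>eigenvalues A. \<exists>v. v \<noteq> 0 \<and> A *v v = l *\<^sub>R v" by (simp add: eigenvalues_def)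
  then obtain v where v: "\<And>l. l \<in> eigenvalues A \<Longrightarrow> v l \<noteq> 0 \<and> A *v (v l) = l *\<^sub>R v l"
    by metis
  have orth: "v l \<bullet> v k = 0" if "l \<in> eigenvalues A" "k \<in> eigenvalues A" "l \<noteq> k" for l k
    using eigenvectors_orthogonal[OF assms] v that by blast
  have "inj_on v (eigenvalues A)"
    using orth v by (metis inj_onI inner_eq_zero_iff)
  moreover have "independent (v ` eigenvalues A)"
    using orth v by (intro pairwise_orthogonal_independent) (auto simp: pairwise_def orthogonal_def)
  then have "finite (v ` eigenvalues A)"
    using independent_imp_finite by blast
  ultimately show ?thesis by (simp add: finite_image_iff)
qed

lemma lambda_min:
  fixes A :: "real^'r^'r"
  assumes "A \<in> symmetric_matrices"
  shows lambda_min_eigenvalue: "lambda_min A \<in> eigenvalues A"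
    and coercive_lambda_min: "coercive (lambda_min A) A"
proof -
  have "(UNIV :: (real^'r) set) \<noteq> {0}"
    by (metis UNIV_I axis_eq_0_iff singletonD zero_neq_one)
  with assms obtain v l where v: "norm v = 1" "A *v v = l *\<^sub>R v"
    and low: "\<And>x. l * (x \<bullet> x) \<le> x \<bullet> (A *v x)"
    using rayleigh_minimum[of A UNIV] by auto
  have l: "l \<in> eigenvalues A"
    using v by (auto simp: eigenvalues_def intro!: exI[of _ v])
  have "l \<le> k" if "k \<in> eigenvalues A" for k
  proof -
    obtain w where "w \<noteq> 0" "A *v w = k *\<^sub>R w" using \<open>k \<in> _\<close> by (auto simp: eigenvalues_def)
    then show ?thesis using low[of w] by simp
  qed
  then have "lambda_min A = l"
    unfolding lambda_min_def using l finite_eigenvalues[OF assms] by (intro Min_eqI) auto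
  then show "lambda_min A \<in> eigenvalues A" "coercive (lambda_min A) A"
    using l low by (auto simp: coercive_def)
qed

lemma posdef_symmetric: "A \<in> posdef_matrices \<Longrightarrow> A \<in> symmetric_matrices"
  by (simp add: posdef_matrices_def)

lemma lambda_min_pos:
  assumes "A \<in> posdef_matrices" shows "lambda_min A > 0"
proof -
  obtain v where v: "v \<noteq> 0" "A *v v = lambda_min A *\<^sub>R v"
    using lambda_min_eigenvalue[OF posdef_symmetric[OF assms]] by (auto simp: eigenvalues_def)
  with assms have "0 < lambda_min A * (v \<bullet> v)"
    unfolding posdef_matrices_def by (metis (mono_tags, lifting) inner_scaleR_right mem_Collect_eq)
  then show ?thesis using inner_ge_zero[of v] by (simp add: zero_less_mult_iff)
qed

lemma posdef_iff:
  "A \<in> posdef_matrices \<longleftrightarrow> A \<in> symmetric_matrices \<and> (\<exists>m>0. coercive m A)"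
proof (intro iffI conjI)
  assume A: "A \<in> posdef_matrices"
  then show sym: "A \<in> symmetric_matrices" by (rule posdef_symmetric)
  show "\<exists>m>0. coercive m A" using lambda_min_pos[OF A] coercive_lambda_min[OF sym] by blast
next
  assume "A \<in> symmetric_matrices \<and> (\<exists>m>0. coercive m A)"
  then obtain m where m: "A \<in> symmetric_matrices" "0 < m" "coercive m A" by blast
  have "x \<bullet> (A *v x) > 0" if "x \<noteq> 0" for x
  proof -
    have "0 < m * (x \<bullet> x)" using m that by simp
    also have "\<dots> \<le> x \<bullet> (A *v x)" using m(3) by (simp add: coercive_def)
    finally show ?thesis .
  qed
  with m(1) show "A \<in> posdef_matrices" by (simp add: posdef_matrices_def)
qed

text \<open>
  The orthogonal projection onto the line of a unit vector \<open>b\<close>.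
\<close>

definition dyad :: "real^'r \<Rightarrow> real^'r^'r" where
  "dyad b = (\<chi> i j. b $ i * b $ j)"

lemma dyad_mult_vector: "dyad b *v x = (b \<bullet> x) *\<^sub>R b"
  by (simp add: dyad_def vec_eq_iff matrix_vector_mult_def inner_vec_def sum_distrib_right
      sum_distrib_left mult_ac)

lemma transpose_dyad: "transpose (dyad b) = dyad b"
  by (simp add: dyad_def transpose_def vec_eq_iff mult.commute)

locale orthonormal_frame =
  fixes B :: "(real^'r) set"
  assumes finite_frame: "finite B"
    and orthonormal: "\<And>b c. b \<in> B \<Longrightarrow> c \<in> B \<Longrightarrow> b \<bullet> c = (if b = c then 1 else 0)"
    and expansion: "\<And>x. (\<Sum>b\<in>B. (b \<bullet> x) *\<^sub>R b) = x"
begin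

text \<open>
  Functional calculus of a matrix that is diagonal in the frame; \<open>f\<close> gives the eigenvalue at
  each frame vector.
\<close>

definition spectral_fun :: "(real^'r \<Rightarrow> real) \<Rightarrow> real^'r^'r" where
  "spectral_fun f = (\<Sum>b\<in>B. f b *\<^sub>R dyad b)"

lemma spectral_fun_mult_vector: "spectral_fun f *v x = (\<Sum>b\<in>B. (f b * (b \<bullet> x)) *\<^sub>R b)"
  by (simp add: spectral_fun_def matvec.sum_left matvec.scaleR_left dyad_mult_vector)

lemma dyad_mult_dyad:
  assumes "b \<in> B" "c \<in> B"
  shows "dyad b ** dyad c = (if b = c then dyad b else 0)"
  using orthonormal[OF assms]
  by (auto simp: matrix_eq dyad_mult_vector matrix_vector_mul_assoc[symmetric])

lemma spectral_fun_one: "spectral_fun (\<lambda>_. 1) = mat 1"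
  by (simp add: matrix_eq spectral_fun_mult_vector expansion)

lemma spectral_fun_mult: "spectral_fun f ** spectral_fun g = spectral_fun (\<lambda>b. f b * g b)"
proof -
  have "spectral_fun f ** spectral_fun g = (\<Sum>b\<in>B. \<Sum>c\<in>B. (f b * g c) *\<^sub>R (dyad b ** dyad c))"
    by (simp add: spectral_fun_def matmul.sum_left matmul.sum_right matmul.scaleR_left matmul.scaleR_right
        scaleR_sum_right) (subst sum.swap, simp add: mult.commute)
  also have "\<dots> = (\<Sum>b\<in>B. \<Sum>c\<in>B. if b = c then (f b * g c) *\<^sub>R dyad b else 0)"
    by (intro sum.cong) (auto simp: dyad_mult_dyad)
  finally show ?thesis by (simp add: finite_frame spectral_fun_def)
qed

lemma spectral_fun_scaleR: "spectral_fun (\<lambda>b. a * f b) = a *\<^sub>R spectral_fun f"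
  by (simp add: spectral_fun_def scaleR_sum_right)

lemma spectral_fun_symmetric: "spectral_fun f \<in> symmetric_matrices"
  by (simp add: symmetric_matrices_def spectral_fun_def linear_sum[OF linear_transpose]
      linear_scale[OF linear_transpose] transpose_dyad)

lemma coercive_spectral_fun:
  assumes "\<And>b. b \<in> B \<Longrightarrow> m \<le> f b"
  shows "coercive m (spectral_fun f)"
  unfolding coercive_def
proof
  fix x
  have "m * (x \<bullet> x) = m * (x \<bullet> (\<Sum>b\<in>B. (b \<bullet> x) *\<^sub>R b))" by (simp add: expansion)
  also have "\<dots> = (\<Sum>b\<in>B. m * (b \<bullet> x)\<^sup>2)"
    by (simp add: inner_sum_right sum_distrib_left power2_eq_square inner_commute)
  also have "\<dots> \<le> (\<Sum>b\<in>B. f b * (b \<bullet> x)\<^sup>2)"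
    using assms by (intro sum_mono mult_right_mono) auto
  also have "\<dots> = x \<bullet> (spectral_fun f *v x)"
    by (simp add: spectral_fun_mult_vector inner_sum_right power2_eq_square inner_commute mult_ac)
  finally show "m * (x \<bullet> x) \<le> x \<bullet> (spectral_fun f *v x)" .
qed

lemma matrix_exp_spectral_fun: "matrix_exp (spectral_fun f) = spectral_fun (\<lambda>b. exp (f b))"
proof -
  have pow: "((\<lambda>X. spectral_fun f ** X) ^^ k) (mat 1) = spectral_fun (\<lambda>b. f b ^ k)" for k
    by (induction k) (simp_all add: spectral_fun_one spectral_fun_mult)
  have "(\<lambda>k. (1 / fact k) *\<^sub>R spectral_fun (\<lambda>b. f b ^ k)) sums spectral_fun (\<lambda>b. exp (f b))"
    unfolding spectral_fun_def scaleR_sum_right scaleR_scaleR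
  proof (intro sums_sum sums_scaleR_left)
    show "(\<lambda>k. 1 / fact k * f b ^ k) sums exp (f b)" for b
      using exp_converges[of "f b"] by (simp add: divide_inverse mult.commute)
  qed
  then show ?thesis by (simp add: matrix_exp_def pow sums_unique[symmetric])
qed

end

lemma orthonormal_independent:
  assumes "\<forall>b\<in>B. \<forall>c\<in>B. b \<bullet> c = (if b = c then 1 else 0)"
  shows "independent (B :: (real^'r) set)"
proof (rule pairwise_orthogonal_independent)
  show "pairwise orthogonal B" using assms by (auto simp: pairwise_def orthogonal_def)
  show "0 \<notin> B" using assms by force
qed

text \<open>
  An orthonormal set of eigenvectors of maximal size spans: its orthogonal complement is invariant
  under \<open>A\<close>, so a nonzero complement would contain one more unit eigenvector.
\<close>

lemma spectral_decomposition:
  fixes A :: "real^'r^'r"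
  assumes sym: "A \<in> symmetric_matrices"
  obtains B l where "orthonormal_frame B" "A = orthonormal_frame.spectral_fun B l"
    "\<And>b. b \<in> B \<Longrightarrow> A *v b = l b *\<^sub>R b"
proof -
  define P where "P B \<longleftrightarrow> (\<forall>b\<in>B. \<forall>c\<in>B. b \<bullet> c = (if b = c then 1 else 0)) \<and>
    (\<forall>b\<in>B. \<exists>l. A *v b = l *\<^sub>R b)" for B
  have fin: "finite B" "card B \<le> DIM(real^'r)" if "P B" for B
    using independent_bound[OF orthonormal_independent[of B]] that unfolding P_def by blast+
  have "P {}" by (simp add: P_def)
  moreover have "\<forall>C. P C \<longrightarrow> card C < Suc DIM(real^'r)" using fin(2) le_imp_less_Suc by blast
  ultimately obtain B where B: "P B" and max: "\<And>C. P C \<Longrightarrow> card C \<le> card B"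
    using ex_has_greatest_nat[of P "{}" card "Suc DIM(real^'r)"] by metis
  obtain l where l: "\<And>b. b \<in> B \<Longrightarrow> A *v b = l b *\<^sub>R b"
    using B unfolding P_def by metis
  define V where "V = {x. \<forall>b\<in>B. b \<bullet> x = 0}"
  have V: "subspace V"
    by (auto simp: V_def subspace_def inner_add_right)
  have inv: "A *v x \<in> V" if "x \<in> V" for x
    using that by (auto simp: V_def symmetric_inner[OF sym] l)
  have "V = {0}"
  proof (rule ccontr)
    assume "V \<noteq> {0}"
    then obtain v k where v: "v \<in> V" "norm v = 1" "A *v v = k *\<^sub>R v"
      using rayleigh_minimum[OF sym V _ inv] by metis
    have "v \<notin> B" using v by (auto simp: V_def)
    moreover have "P (insert v B)"
      using B v by (auto simp: P_def V_def inner_commute norm_eq_1)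
    ultimately show False using max[of "insert v B"] fin(1)[OF B] by simp
  qed
  have "(\<Sum>b\<in>B. (b \<bullet> x) *\<^sub>R b) = x" for x
  proof -
    have "x - (\<Sum>b\<in>B. (b \<bullet> x) *\<^sub>R b) \<in> V"
    proof (unfold V_def, clarify)
      fix b assume "b \<in> B"
      then have "(\<Sum>c\<in>B. (c \<bullet> x) * (b \<bullet> c)) = (\<Sum>c\<in>B. if b = c then c \<bullet> x else 0)"
        using B by (intro sum.cong) (auto simp: P_def)
      with \<open>b \<in> B\<close> fin(1)[OF B] show "b \<bullet> (x - (\<Sum>b\<in>B. (b \<bullet> x) *\<^sub>R b)) = 0"
        by (simp add: inner_diff_right inner_sum_right)
    qed
    with \<open>V = {0}\<close> show ?thesis by simp
  qed
  then interpret orthonormal_frame B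
    using B fin(1)[OF B] by unfold_locales (auto simp: P_def)
  have "A *v x = spectral_fun l *v x" for x
  proof -
    have "A *v x = A *v (\<Sum>b\<in>B. (b \<bullet> x) *\<^sub>R b)" by (simp only: expansion)
    also have "\<dots> = spectral_fun l *v x"
      by (simp add: matvec.sum_right matvec.scaleR_right l spectral_fun_mult_vector mult.commute)
    finally show ?thesis .
  qed
  then have "A = spectral_fun l" by (simp add: matrix_eq)
  then show ?thesis using that[of B l] l orthonormal_frame_axioms by blast
qed

section \<open>The principal square root\<close>

text \<open>
  If \<open>R\<close> and \<open>S\<close> have equal squares then \<open>R ** (R - S) + (R - S) ** S = 0\<close>, a homogeneous Sylvester
  equation.
\<close>

lemma principal_sqrt_unique:
  assumes "R \<in> posdef_matrices" "S \<in> posdef_matrices" "R ** R = S ** S"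
  shows "R = S"
proof -
  obtain a b where "a > 0" "coercive a R" "b > 0" "coercive b S"
    using assms(1,2) by (auto simp: posdef_iff)
  then show ?thesis
    using assms(3) sylvester_norm_bound[of a R b S "R - S"]
    by (simp add: matmul.diff_left matmul.diff_right mult_le_0_iff)
qed

text \<open>
  Take square roots of the eigenvalues. The third property transports a lower bound from \<open>A\<close> to its
  root; all later estimates depend on \<open>A\<close> only through it.
\<close>

lemma principal_sqrt_exists:
  assumes "A \<in> posdef_matrices"
  obtains R where "R \<in> posdef_matrices" "R ** R = A"
    "\<And>m. 0 < m \<Longrightarrow> coercive m A \<Longrightarrow> coercive (sqrt m) R"
proof -
  obtain B l where "orthonormal_frame B" and A: "A = orthonormal_frame.spectral_fun B l"
    and eig: "\<And>b. b \<in> B \<Longrightarrow> A *v b = l b *\<^sub>R b"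
    using spectral_decomposition[OF posdef_symmetric[OF assms]] by metis
  interpret orthonormal_frame B by fact
  define R where "R = spectral_fun (\<lambda>b. sqrt (l b))"
  have eig_ge: "m \<le> l b" if "coercive m A" "b \<in> B" for m b
    using that(1)[unfolded coercive_def, rule_format, of b] eig[OF that(2)] orthonormal[of b b] that(2)
    by simp
  have pos: "l b > 0" if "b \<in> B" for b
    using assms eig_ge that unfolding posdef_iff by force
  have co: "coercive (sqrt m) R" if "coercive m A" for m
    unfolding R_def using eig_ge[OF that] by (intro coercive_spectral_fun) simp
  obtain m where "m > 0" "coercive m A" using assms by (auto simp: posdef_iff)
  then have "R \<in> posdef_matrices"
    using co[of m] spectral_fun_symmetric by (auto simp: posdef_iff R_def intro!: exI[of _ "sqrt m"])
  moreover have "R ** R = A"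
    unfolding R_def A spectral_fun_mult by (auto simp: spectral_fun_def pos less_imp_le intro!: sum.cong)
  ultimately show ?thesis using that co by blast
qed

lemma principal_sqrt:
  assumes "A \<in> posdef_matrices"
  shows principal_sqrt_posdef: "principal_sqrt A \<in> posdef_matrices"
    and principal_sqrt_square: "principal_sqrt A ** principal_sqrt A = A"
    and coercive_principal_sqrt: "0 < m \<Longrightarrow> coercive m A \<Longrightarrow> coercive (sqrt m) (principal_sqrt A)"
proof -
  obtain R where R: "R \<in> posdef_matrices" "R ** R = A"
    "\<And>m. 0 < m \<Longrightarrow> coercive m A \<Longrightarrow> coercive (sqrt m) R"
    using principal_sqrt_exists[OF assms] by metis
  have "principal_sqrt A = R"
    unfolding principal_sqrt_def using R principal_sqrt_unique by (intro the_equality) auto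
  with R show "principal_sqrt A \<in> posdef_matrices" "principal_sqrt A ** principal_sqrt A = A"
    "0 < m \<Longrightarrow> coercive m A \<Longrightarrow> coercive (sqrt m) (principal_sqrt A)" by auto
qed

section \<open>Solution of the Sylvester equation\<close>

text \<open>
  For positive definite \<open>R\<close>, the inverse of the derivative of \<open>R \<mapsto> R ** R\<close>.
\<close>

definition sylvester :: "real^'r^'r \<Rightarrow> real^'r^'r \<Rightarrow> real^'r^'r" where
  "sylvester R Y = (THE X. R ** X + X ** R = Y)"

lemma sylvester_eqI:
  assumes "R \<in> posdef_matrices" "R ** X + X ** R = Y"
  shows "sylvester R Y = X"
proof -
  obtain m where "m > 0" "coercive m R" using assms(1) by (auto simp: posdef_iff)
  then have "Z = X" if "R ** Z + Z ** R = Y" for Z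
    using sylvester_unique[of m R m R Z X] assms(2) that by simp
  then show ?thesis unfolding sylvester_def using assms(2) by blast
qed

text \<open>
  In an eigenframe of \<open>R\<close> with eigenvalues \<open>l b\<close>, the operator \<open>X \<mapsto> R ** X + X ** R\<close> multiplies
  the block \<open>dyad b ** Y ** dyad c\<close> by \<open>l b + l c\<close>, while conjugation with the exponential multiplies
  it by \<open>exp (- (l b + l c) * t)\<close>, whose integral over the half-line is \<open>1 / (l b + l c)\<close>.
\<close>

lemma sylvester_integral:
  assumes "R \<in> posdef_matrices"
  shows sylvester_absolutely_integrable:
      "(\<lambda>t. matrix_exp (- t *\<^sub>R R) ** Y ** matrix_exp (- t *\<^sub>R R)) absolutely_integrable_on {0..}"
    and sylvester_has_integral:
      "((\<lambda>t. matrix_exp (- t *\<^sub>R R) ** Y ** matrix_exp (- t *\<^sub>R R)) has_integral sylvester R Y) {0..}"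
    and sylvester_solves: "R ** sylvester R Y + sylvester R Y ** R = Y"
proof -
  obtain B l where "orthonormal_frame B" and R: "R = orthonormal_frame.spectral_fun B l"
    and eig: "\<And>b. b \<in> B \<Longrightarrow> R *v b = l b *\<^sub>R b"
    using spectral_decomposition[OF posdef_symmetric[OF assms]] by metis
  interpret orthonormal_frame B by fact
  have pos: "l b > 0" if "b \<in> B" for b
  proof -
    have "b \<noteq> 0" using orthonormal[of b b] that by auto
    then have "b \<bullet> (R *v b) > 0" using assms by (simp add: posdef_matrices_def)
    then show ?thesis using orthonormal[of b b] eig that by simp
  qed
  define E where "E b c = dyad b ** Y ** dyad c" for b c
  define X where "X = (\<Sum>b\<in>B. \<Sum>c\<in>B. (1 / (l b + l c)) *\<^sub>R E b c)"
  have sandwich: "spectral_fun f ** Y ** spectral_fun g = (\<Sum>b\<in>B. \<Sum>c\<in>B. (f b * g c) *\<^sub>R E b c)" for f g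
    unfolding spectral_fun_def E_def
    by (simp add: matmul.sum_left matmul.sum_right matmul.scaleR_left matmul.scaleR_right
        scaleR_sum_right mult.commute) (rule sum.swap)
  have conj: "matrix_exp (- t *\<^sub>R R) ** Y ** matrix_exp (- t *\<^sub>R R) =
      (\<Sum>b\<in>B. \<Sum>c\<in>B. exp (- (l b + l c) * t) *\<^sub>R E b c)" for t
  proof -
    have "- t *\<^sub>R R = spectral_fun (\<lambda>b. - t * l b)" by (simp only: R spectral_fun_scaleR)
    then show ?thesis
      by (simp add: matrix_exp_spectral_fun sandwich exp_add[symmetric] algebra_simps)
  qed
  have left: "R ** E b c = l b *\<^sub>R E b c" if "b \<in> B" "c \<in> B" for b c
  proof -
    have "R ** dyad b = l b *\<^sub>R dyad b"
      by (simp add: matrix_eq matrix_vector_mul_assoc[symmetric] dyad_mult_vector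
          matvec.scaleR_right matvec.scaleR_left eig that mult.commute)
    then show ?thesis by (simp add: E_def matrix_mul_assoc matmul.scaleR_left)
  qed
  have right: "E b c ** R = l c *\<^sub>R E b c" if "b \<in> B" "c \<in> B" for b c
  proof -
    have "dyad c ** R = l c *\<^sub>R dyad c"
      using symmetric_inner[OF posdef_symmetric[OF assms], of c]
      by (simp add: matrix_eq matrix_vector_mul_assoc[symmetric] dyad_mult_vector
          matvec.scaleR_right matvec.scaleR_left eig that)
    then show ?thesis by (simp add: E_def matrix_mul_assoc[symmetric] matmul.scaleR_right)
  qed
  have "R ** X + X ** R = (\<Sum>b\<in>B. \<Sum>c\<in>B. (1 / (l b + l c)) *\<^sub>R (R ** E b c + E b c ** R))"
    by (simp add: X_def matmul.sum_left matmul.sum_right matmul.scaleR_left matmul.scaleR_right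
        sum.distrib scaleR_add_right)
  also have "\<dots> = (\<Sum>b\<in>B. \<Sum>c\<in>B. E b c)"
  proof (intro sum.cong refl)
    fix b c assume bc: "b \<in> B" "c \<in> B"
    then have "l b + l c \<noteq> 0" using pos by (metis add_pos_pos less_irrefl)
    then show "(1 / (l b + l c)) *\<^sub>R (R ** E b c + E b c ** R) = E b c"
      by (simp add: left right bc scaleR_left_distrib[symmetric])
  qed
  also have "\<dots> = Y" using sandwich[of "\<lambda>_. 1" "\<lambda>_. 1"] by (simp add: spectral_fun_one)
  finally have X: "R ** X + X ** R = Y" .
  then have sylv: "sylvester R Y = X" by (rule sylvester_eqI[OF assms])
  with X show "R ** sylvester R Y + sylvester R Y ** R = Y" by simp
  have lin: "bounded_linear (\<lambda>s::real. s *\<^sub>R E b c)" for b c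
    by (rule bounded_linear_scaleR_left)
  have exp_int: "((\<lambda>t. exp (- (l b + l c) * t)) has_integral 1 / (l b + l c)) {0..}"
    if "b \<in> B" "c \<in> B" for b c
    using has_integral_exp_minus_to_infinity[of "l b + l c" 0] pos that by (simp add: add_pos_pos)
  show "((\<lambda>t. matrix_exp (- t *\<^sub>R R) ** Y ** matrix_exp (- t *\<^sub>R R)) has_integral sylvester R Y) {0..}"
    unfolding sylv X_def conj
    by (intro has_integral_sum finite_frame has_integral_linear[OF exp_int lin, unfolded o_def])
  show "(\<lambda>t. matrix_exp (- t *\<^sub>R R) ** Y ** matrix_exp (- t *\<^sub>R R)) absolutely_integrable_on {0..}"
    unfolding conj
    by (intro absolutely_integrable_sum finite_frame
        absolutely_integrable_linear[OF _ lin, unfolded o_def] nonnegative_absolutely_integrable_1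
        has_integral_integrable[OF exp_int]) auto
qed

lemma linear_sylvester:
  assumes "R \<in> posdef_matrices"
  shows "linear (sylvester R)"
  by (rule linearI; rule sylvester_eqI[OF assms])
    (simp_all add: matmul.add_left matmul.add_right matmul.scaleR_left matmul.scaleR_right
      sylvester_solves[OF assms] add.commute add.left_commute add.assoc
      flip: scaleR_add_right)

text \<open>
  The transpose of a solution solves the transposed equation, and solutions are unique.
\<close>

lemma sylvester_symmetric:
  assumes "R \<in> posdef_matrices" "Y \<in> symmetric_matrices"
  shows "sylvester R Y \<in> symmetric_matrices"
proof -
  let ?X = "sylvester R Y"
  have "transpose R = R" "transpose Y = Y"
    using assms posdef_symmetric by (auto simp: symmetric_matrices_def)
  then have "R ** transpose ?X + transpose ?X ** R = Y"
    using arg_cong[OF sylvester_solves[OF assms(1), of Y], of transpose]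
    by (simp add: linear_add[OF linear_transpose] matrix_transpose_mul add.commute)
  then show ?thesis
    using sylvester_eqI[OF assms(1)] by (fastforce simp: symmetric_matrices_def)
qed

section \<open>Differentiating the solution of a Sylvester equation\<close>

text \<open>
  Where the left factor vanishes, the product rule asks of the right factor only that it converges.
  So a product can be differentiated before its right factor is known to be differentiable.
\<close>

lemma (in bounded_bilinear) has_derivative_vanishing_left:
  assumes f: "(f has_derivative f') (at a within S)" and fa: "f a = 0"
    and g: "(g \<longlongrightarrow> l) (at a within S)"
  shows "((\<lambda>x. prod (f x) (g x)) has_derivative (\<lambda>h. prod (f' h) l)) (at a within S)"
  unfolding has_derivative_at_within
proof (intro conjI)
  have lin: "bounded_linear f'" using f by (rule has_derivative_bounded_linear)
  show "bounded_linear (\<lambda>h. prod (f' h) l)"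
    by (intro bounded_linear_compose[OF bounded_linear_left lin])
  obtain K where K: "\<And>x. norm (f' x) \<le> norm x * K" "K > 0"
    using bounded_linear.pos_bounded[OF lin] by blast
  have "((\<lambda>y. prod ((f y - f a - f' (y - a)) /\<^sub>R norm (y - a)) (g y)) \<longlongrightarrow> prod 0 l) (at a within S)"
    using f g by (intro tendsto) (auto simp: has_derivative_at_within)
  moreover have "Bfun (\<lambda>y. f' (y - a) /\<^sub>R norm (y - a)) (at a within S)"
  proof (rule BfunI)
    have "norm (f' (y - a) /\<^sub>R norm (y - a)) \<le> K" for y
      using K(1)[of "y - a"] K(2) by (cases "y = a") (simp_all add: divide_simps mult.commute)
    then show "\<forall>\<^sub>F y in at a within S. norm (f' (y - a) /\<^sub>R norm (y - a)) \<le> K" by simp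
  qed
  then have "((\<lambda>y. prod (f' (y - a) /\<^sub>R norm (y - a)) (g y - l)) \<longlongrightarrow> 0) (at a within S)"
    using g Bfun_prod_Zfun[of _ "at a within S" "\<lambda>y. g y - l"]
    by (simp add: tendsto_Zfun_iff)
  ultimately have "((\<lambda>y. prod ((f y - f a - f' (y - a)) /\<^sub>R norm (y - a)) (g y)
      + prod (f' (y - a) /\<^sub>R norm (y - a)) (g y - l)) \<longlongrightarrow> 0) (at a within S)"
    using tendsto_add by (fastforce simp: zero_left)
  moreover have "prod ((f y - f a - f' (y - a)) /\<^sub>R norm (y - a)) (g y)
      + prod (f' (y - a) /\<^sub>R norm (y - a)) (g y - l)
      = (prod (f y) (g y) - prod (f a) (g a) - prod (f' (y - a)) l) /\<^sub>R norm (y - a)" for y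
    by (simp add: fa zero_left scaleR_left diff_left diff_right scaleR_diff_right)
  ultimately show "((\<lambda>y. (prod (f y) (g y) - prod (f a) (g a) - prod (f' (y - a)) l) /\<^sub>R norm (y - a)) \<longlongrightarrow> 0)
      (at a within S)"
    by simp
qed

lemma eventually_in_at_within: "\<forall>\<^sub>F x in at a within S. x \<in> S"
  by (simp add: eventually_at_filter)

text \<open>
  Subtracting the equations at \<open>x\<close> and \<open>a\<close> expresses \<open>F x - F a\<close> as the solution, for the fixed
  coefficient \<open>R a\<close>, with right-hand side \<open>W x\<close>. In \<open>W\<close> the values \<open>F x\<close> occur only multiplied by
  \<open>R x - R a\<close>, which vanishes at \<open>a\<close>. Near \<open>a\<close> these terms are absorbed by the left-hand side, which
  gives continuity of \<open>F\<close>; then \<open>W\<close> is differentiable by the product rule above, and so is \<open>F\<close>.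
\<close>

lemma sylvester_solution_has_derivative:
  fixes R P F :: "'a::real_normed_vector \<Rightarrow> real^'r^'r"
  assumes R: "(R has_derivative R') (at a within U)" and P: "(P has_derivative P') (at a within U)"
    and eq: "\<And>x. x \<in> U \<Longrightarrow> R x ** F x + F x ** R x = P x"
    and a: "a \<in> U" "R a \<in> posdef_matrices"
  shows "(F has_derivative (\<lambda>h. sylvester (R a) (P' h - R' h ** F a - F a ** R' h))) (at a within U)"
proof -
  let ?L = "sylvester (R a)"
  have lin: "bounded_linear ?L" using linear_sylvester[OF a(2)] by (simp add: linear_linear)
  obtain C where C: "\<And>Y. norm (?L Y) \<le> norm Y * C" "C > 0"
    using bounded_linear.pos_bounded[OF lin] by blast
  define W where "W x = P x - P a - (R x - R a) ** F x - F x ** (R x - R a)" for x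
  have F: "F x = F a + ?L (W x)" if "x \<in> U" for x
  proof -
    have "R a ** (F x - F a) + (F x - F a) ** R a = W x"
      using eq[OF that] eq[OF a(1)] by (simp add: W_def matmul.diff_left matmul.diff_right algebra_simps)
    from sylvester_eqI[OF a(2) this] show ?thesis by simp
  qed
  have Rc: "((\<lambda>x. R x - R a) \<longlongrightarrow> 0) (at a within U)"
    using has_derivative_continuous[OF R] by (simp add: continuous_within LIM_zero)
  have Pc: "((\<lambda>x. P x - P a) \<longlongrightarrow> 0) (at a within U)"
    using has_derivative_continuous[OF P] by (simp add: continuous_within LIM_zero)
  have small: "\<forall>\<^sub>F x in at a within U. norm (R x - R a) < 1 / (4 * C)"
    using tendstoD[OF Rc, of "1 / (4 * C)"] C(2) by simp
  have "\<forall>\<^sub>F x in at a within U. norm (F x - F a) \<le> 2 * C * (norm (P x - P a) + 2 * norm (R x - R a) * norm (F a))"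
    using small eventually_in_at_within
  proof eventually_elim
    case (elim x)
    \<comment> \<open>\<open>2 * C * r \<le> 1 / 2\<close>, so the term with \<open>F x - F a\<close> moves to the left\<close>
    define r where "r = norm (R x - R a)"
    have "norm (W x) \<le> norm (P x - P a) + r * norm (F x) + norm (F x) * r"
      unfolding W_def r_def
      by (intro norm_triangle_le_diff order_trans[OF norm_triangle_ineq4] add_mono norm_matrix_mult_le order_refl)
    then have "norm (?L (W x)) \<le> (norm (P x - P a) + r * norm (F x) + norm (F x) * r) * C"
      using C by (meson mult_right_mono less_imp_le order_trans)
    then have 1: "norm (F x - F a) \<le> C * norm (P x - P a) + (2 * C * r) * norm (F x)"
      using F[OF elim(2)] by (simp add: algebra_simps)
    have "norm (F x) \<le> norm (F a) + norm (F x - F a)"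
      by (metis add.commute norm_triangle_sub)
    then have "(2 * C * r) * norm (F x) \<le> (2 * C * r) * norm (F a) + (2 * C * r) * norm (F x - F a)"
      unfolding distrib_left[symmetric] using C(2) by (intro mult_left_mono) (simp_all add: r_def)
    also have "(2 * C * r) * norm (F x - F a) \<le> (1/2) * norm (F x - F a)"
      using elim(1) C(2) by (intro mult_right_mono) (simp_all add: r_def field_simps)
    finally show ?case using 1 by (simp add: r_def algebra_simps)
  qed
  moreover have lim: "((\<lambda>x. 2 * C * (norm (P x - P a) + 2 * norm (R x - R a) * norm (F a))) \<longlongrightarrow>
      2 * C * (norm (0 :: real^'r^'r) + 2 * norm (0 :: real^'r^'r) * norm (F a))) (at a within U)"
    by (intro tendsto_intros Rc Pc)
  ultimately have "((\<lambda>x. F x - F a) \<longlongrightarrow> 0) (at a within U)"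
    using Lim_null_comparison by fastforce
  then have Fc: "(F \<longlongrightarrow> F a) (at a within U)" by (rule LIM_zero_cancel)
  have R0: "((\<lambda>x. R x - R a) has_derivative R') (at a within U)"
    using has_derivative_diff[OF R has_derivative_const[of "R a"]] by simp
  have P0: "((\<lambda>x. P x - P a) has_derivative P') (at a within U)"
    using has_derivative_diff[OF P has_derivative_const[of "P a"]] by simp
  have "(W has_derivative (\<lambda>h. P' h - R' h ** F a - F a ** R' h)) (at a within U)"
    unfolding W_def
    by (intro has_derivative_diff P0 matmul.has_derivative_vanishing_left[OF R0 _ Fc]
        bounded_bilinear.has_derivative_vanishing_left[OF matmul.flip R0 _ Fc]) simp_all
  from has_derivative_add[OF has_derivative_const[of "F a"] bounded_linear.has_derivative[OF lin this]]
  have "((\<lambda>x. F a + ?L (W x)) has_derivative (\<lambda>h. ?L (P' h - R' h ** F a - F a ** R' h))) (at a within U)"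
    by simp
  then show ?thesis
    by (rule has_derivative_transform[OF a(1), rotated]) (rule F)
qed

text \<open>
  For \<open>X = principal_sqrt B - principal_sqrt A\<close>, the mixed equation with both roots has right-hand
  side \<open>B - A\<close> and yields \<open>norm X = O (norm (B - A))\<close>; the equation with the root of \<open>A\<close> on both sides
  has right-hand side \<open>B - A - X ** X\<close>, so the error of the linearisation is quadratic.
\<close>

lemma principal_sqrt_has_derivative:
  fixes A :: "real^'r^'r"
  assumes A: "A \<in> posdef_matrices"
  shows "(principal_sqrt has_derivative sylvester (principal_sqrt A)) (at A within posdef_matrices)"
proof -
  let ?R = "principal_sqrt A" and ?L = "sylvester (principal_sqrt A)"
  have lin: "bounded_linear ?L"
    using linear_sylvester[OF principal_sqrt_posdef[OF A]] by (simp add: linear_linear)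
  obtain C where C: "\<And>Y. norm (?L Y) \<le> norm Y * C" "C > 0"
    using bounded_linear.pos_bounded[OF lin] by blast
  obtain m where m: "m > 0" "coercive m ?R"
    using principal_sqrt_posdef[OF A] by (auto simp: posdef_iff)
  show ?thesis
  proof (rule has_derivativeI_sandwich[of 1])
    fix B :: "real^'r^'r" assume B: "B \<in> posdef_matrices" "B \<noteq> A"
    define X where "X = principal_sqrt B - ?R"
    obtain n where n: "n > 0" "coercive n (principal_sqrt B)"
      using principal_sqrt_posdef[OF B(1)] by (auto simp: posdef_iff)
    have "m * norm X \<le> (m + n) * norm X" using n by (simp add: mult_right_mono)
    also have "\<dots> \<le> norm (?R ** X + X ** principal_sqrt B)"
      by (rule sylvester_norm_bound[OF m(2) n(2)])
    also have "?R ** X + X ** principal_sqrt B = B - A"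
      using principal_sqrt_square[OF A] principal_sqrt_square[OF B(1)]
      by (simp add: X_def matmul.diff_left matmul.diff_right)
    finally have X: "norm X \<le> norm (B - A) / m" using m by (simp add: field_simps)
    have "?R ** X + X ** ?R = B - A - X ** X"
      using principal_sqrt_square[OF A] principal_sqrt_square[OF B(1)]
      by (simp add: X_def matmul.diff_left matmul.diff_right)
    then have "?L (B - A - X ** X) = X"
      by (rule sylvester_eqI[OF principal_sqrt_posdef[OF A]])
    then have "?L (B - A) - ?L (X ** X) = X"
      by (simp only: linear_diff[OF bounded_linear.linear[OF lin]])
    then have "X - ?L (B - A) = - ?L (X ** X)"
      by (metis add_diff_cancel_left' diff_conv_add_uminus)
    then have "norm (X - ?L (B - A)) \<le> norm (X ** X) * C" using C(1) by simp
    also have "\<dots> \<le> (norm X * norm X) * C"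
      using C(2) by (intro mult_right_mono norm_matrix_mult_le) simp
    also have "\<dots> \<le> (norm (B - A) / m * (norm (B - A) / m)) * C"
      using C(2) m(1) X by (intro mult_right_mono mult_mono) auto
    finally show "norm (principal_sqrt B - ?R - ?L (B - A)) / norm (B - A) \<le> norm (B - A) * (C / m\<^sup>2)"
      using B(2) m by (simp add: X_def field_simps power2_eq_square)
  next
    have "((\<lambda>B. norm (B - A) * (C / m\<^sup>2)) \<longlongrightarrow> norm (A - A) * (C / m\<^sup>2)) (at A within posdef_matrices)"
      by (intro tendsto_intros)
    then show "((\<lambda>B. norm (B - A) * (C / m\<^sup>2)) \<longlongrightarrow> 0) (at A within posdef_matrices)" by simp
  qed (use lin in auto)
qed

section \<open>Leibniz sums over the splittings of a list\<close>

text \<open>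
  All ways to distribute the entries of a list over two nonempty sublists, in the order of the list.
  Entries are distinguished by position: a list of \<open>n\<close> equal entries has \<open>2 ^ n - 2\<close> splittings, which
  is what produces binomial coefficients in a single direction.
\<close>

primrec proper_splits :: "'a list \<Rightarrow> ('a list \<times> 'a list) list" where
  "proper_splits [] = []"
| "proper_splits (x # xs) = (if xs = [] then [] else ([x], xs) # (xs, [x]) #
     map (\<lambda>(ys, zs). (x # ys, zs)) (proper_splits xs) @
     map (\<lambda>(ys, zs). (ys, x # zs)) (proper_splits xs))"

lemma proper_splits_length:
  "(ys, zs) \<in> set (proper_splits xs) \<Longrightarrow>
    length ys + length zs = length xs \<and> 0 < length ys \<and> 0 < length zs"
  by (induction xs arbitrary: ys zs) (auto split: if_splits)

lemma proper_splits_set: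
  "(ys, zs) \<in> set (proper_splits xs) \<Longrightarrow> set ys \<subseteq> set xs \<and> set zs \<subseteq> set xs"
  by (induction xs arbitrary: ys zs) (fastforce split: if_splits)+

text \<open>
  The terms of the general Leibniz rule for the product \<open>f ** g\<close> in which both factors are
  differentiated at least once.
\<close>

definition leibniz ::
    "('a list \<Rightarrow> real^'r^'r) \<Rightarrow> ('a list \<Rightarrow> real^'r^'r) \<Rightarrow> 'a list \<Rightarrow> real^'r^'r" where
  "leibniz f g xs = (\<Sum>(ys, zs)\<leftarrow>proper_splits xs. f ys ** g zs)"

lemma leibniz_Nil [simp]: "leibniz f g [] = 0"
  and leibniz_singleton [simp]: "leibniz f g [x] = 0"
  by (simp_all add: leibniz_def)

text \<open>
  A new direction \<open>x\<close> differentiates either factor. It stands alone in the first two terms, and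
  joins an existing nonempty part in the other two.
\<close>

lemma leibniz_Cons:
  assumes "xs \<noteq> []"
  shows "leibniz f g (x # xs) = f [x] ** g xs + f xs ** g [x]
    + leibniz (\<lambda>ys. f (x # ys)) g xs + leibniz f (\<lambda>zs. g (x # zs)) xs"
  using assms by (simp add: leibniz_def case_prod_unfold o_def)

lemma leibniz_cong:
  assumes "\<And>ys zs. (ys, zs) \<in> set (proper_splits xs) \<Longrightarrow> f ys = f' ys \<and> g zs = g' zs"
  shows "leibniz f g xs = leibniz f' g' xs"
  unfolding leibniz_def using assms by (intro arg_cong[where f=sum_list] map_cong) auto

lemma transpose_leibniz:
  "transpose (leibniz f g xs) = leibniz (\<lambda>zs. transpose (g zs)) (\<lambda>ys. transpose (f ys)) xs"
proof (induction xs arbitrary: f g)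
  case (Cons x xs)
  then show ?case
    by (cases "xs = []") (simp_all add: leibniz_Cons linear_add[OF linear_transpose] linear_0[OF linear_transpose]
        matrix_transpose_mul add_ac)
qed (simp add: linear_0[OF linear_transpose])

lemma leibniz_symmetric:
  assumes "\<And>ys zs. (ys, zs) \<in> set (proper_splits xs) \<Longrightarrow>
    f ys \<in> symmetric_matrices \<and> f zs \<in> symmetric_matrices"
  shows "leibniz f f xs \<in> symmetric_matrices"
proof -
  have "leibniz (\<lambda>zs. transpose (f zs)) (\<lambda>ys. transpose (f ys)) xs = leibniz f f xs"
    using assms by (intro leibniz_cong) (auto simp: symmetric_matrices_def)
  then show ?thesis by (simp add: symmetric_matrices_def transpose_leibniz)
qed

lemma has_derivative_sum_list:
  assumes "\<And>p. p \<in> set ps \<Longrightarrow> ((\<lambda>x. F x p) has_derivative (\<lambda>h. F' h p)) net"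
  shows "((\<lambda>x. \<Sum>p\<leftarrow>ps. F x p) has_derivative (\<lambda>h. \<Sum>p\<leftarrow>ps. F' h p)) net"
  using assms by (induction ps) (auto intro!: has_derivative_add)

lemma has_derivative_leibniz:
  assumes "\<And>ys zs. (ys, zs) \<in> set (proper_splits xs) \<Longrightarrow>
      ((\<lambda>x. f x ys) has_derivative (\<lambda>h. f' h ys)) (at a within S) \<and>
      ((\<lambda>x. g x zs) has_derivative (\<lambda>h. g' h zs)) (at a within S)"
  shows "((\<lambda>x. leibniz (f x) (g x) xs) has_derivative
      (\<lambda>h. leibniz (f' h) (g a) xs + leibniz (f a) (g' h) xs)) (at a within S)"
proof -
  have "((\<lambda>x. \<Sum>p\<leftarrow>proper_splits xs. f x (fst p) ** g x (snd p)) has_derivative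
    (\<lambda>h. \<Sum>p\<leftarrow>proper_splits xs. f a (fst p) ** g' h (snd p) + f' h (fst p) ** g a (snd p))) (at a within S)"
    using assms by (intro has_derivative_sum_list matmul.FDERIV) auto
  then show ?thesis
    by (simp add: leibniz_def case_prod_unfold sum_list_addf add.commute)
qed

text \<open>
  Linearity in every slot of a list of length at most \<open>n\<close>; the cutoff makes it provable by induction
  on \<open>n\<close> for functions defined by recursion on the length.
\<close>

definition multilinear_upto :: "nat \<Rightarrow> ('a::real_vector list \<Rightarrow> 'b::real_vector) \<Rightarrow> bool" where
  "multilinear_upto n f \<longleftrightarrow>
     (\<forall>us vs. length us + length vs < n \<longrightarrow> linear (\<lambda>x. f (us @ x # vs)))"

lemma linear_matmul_left: "linear f \<Longrightarrow> linear (\<lambda>x. f x ** (C :: real^'r^'r))"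
  and linear_matmul_right: "linear f \<Longrightarrow> linear (\<lambda>x. (C :: real^'r^'r) ** f x)"
  using linear_compose[OF _ bounded_linear.linear[OF matmul.bounded_linear_left]]
    linear_compose[OF _ bounded_linear.linear[OF matmul.bounded_linear_right]]
  by (auto simp: o_def)

lemma linear_leibniz_left:
  assumes "\<And>ys zs. (ys, zs) \<in> set (proper_splits xs) \<Longrightarrow> linear (\<lambda>x. f x ys)"
  shows "linear (\<lambda>x. leibniz (f x) g xs)"
proof -
  have "linear (\<lambda>x. \<Sum>(ys, zs)\<leftarrow>ps. f x ys ** g zs)"
    if "\<And>ys zs. (ys, zs) \<in> set ps \<Longrightarrow> linear (\<lambda>x. f x ys)" for ps
    using that by (induction ps) (auto intro!: linear_compose_add linear_matmul_left linear_zero)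
  then show ?thesis using assms by (simp add: leibniz_def)
qed

lemma linear_leibniz_right:
  assumes "\<And>ys zs. (ys, zs) \<in> set (proper_splits xs) \<Longrightarrow> linear (\<lambda>x. g x zs)"
  shows "linear (\<lambda>x. leibniz f (g x) xs)"
proof -
  have "linear (\<lambda>x. \<Sum>(ys, zs)\<leftarrow>ps. f ys ** g x zs)"
    if "\<And>ys zs. (ys, zs) \<in> set ps \<Longrightarrow> linear (\<lambda>x. g x zs)" for ps
    using that by (induction ps) (auto intro!: linear_compose_add linear_matmul_right linear_zero)
  then show ?thesis using assms by (simp add: leibniz_def)
qed

text \<open>
  A list of length \<open>n + 1\<close> splits into proper parts of length at most \<open>n\<close>, so the factors need to be
  multilinear only up to \<open>n\<close>.
\<close>

lemma linear_leibniz: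
  assumes "multilinear_upto n f" "multilinear_upto n g" "length us + length vs \<le> n"
  shows "linear (\<lambda>x. leibniz f g (us @ x # vs))"
  using assms
proof (induction us arbitrary: f g n)
  case Nil
  show ?case
  proof (cases "vs = []")
    case False
    have lin: "linear (\<lambda>x. f (x # ys))" "linear (\<lambda>x. g (x # ys))" if "length ys < n" for ys
      using Nil.prems(1,2)[unfolded multilinear_upto_def, rule_format, of "[]" ys] that by auto
    show ?thesis
      using False Nil.prems(3)
      by (auto simp flip: length_greater_0_conv simp: leibniz_Cons dest!: proper_splits_length intro!: linear_compose_add linear_matmul_left
          linear_matmul_right linear_leibniz_left linear_leibniz_right lin)
  qed (simp add: linear_zero)
next
  case (Cons u us)
  have tail: "multilinear_upto (n - 1) f" "multilinear_upto (n - 1) g"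
    using Cons.prems by (auto simp: multilinear_upto_def)
  have "linear (\<lambda>x. f (u # vs @ x # ws)) \<and> linear (\<lambda>x. g (u # vs @ x # ws))"
    if "length vs + length ws < n - 1" for vs ws
    using Cons.prems(1,2)[unfolded multilinear_upto_def, rule_format, of "u # vs" ws] that by auto
  then have "multilinear_upto (n - 1) (\<lambda>ys. f (u # ys))" "multilinear_upto (n - 1) (\<lambda>ys. g (u # ys))"
    by (auto simp: multilinear_upto_def)
  moreover have "length us + length vs < n" "length us + length vs \<le> n - 1" using Cons.prems by auto
  ultimately show ?case
    using Cons.prems(1,2) tail
    by (auto simp: leibniz_Cons multilinear_upto_def intro!: linear_compose_add linear_matmul_left
          linear_matmul_right Cons.IH[of "n - 1"])
qed

section \<open>The higher derivatives of the square root\<close>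

text \<open>
  The list contains the directions of differentiation. Differentiating
  \<open>principal_sqrt A ** principal_sqrt A = A\<close> in the directions \<open>Xs\<close> gives a Sylvester equation for the
  derivative: on the left the two terms in which one factor takes all directions, on the right the
  derivative of the identity (nonzero only at order one) minus the proper Leibniz terms. Solving it
  defines the derivatives by recursion on the number of directions.
\<close>

function sqrt_derivative :: "real^'r^'r \<Rightarrow> (real^'r^'r) list \<Rightarrow> real^'r^'r" where
  "sqrt_derivative A [] = principal_sqrt A"
| "sqrt_derivative A (X # Xs) = sylvester (principal_sqrt A)
     ((if Xs = [] then X else 0) -
      (\<Sum>(ys, zs)\<leftarrow>proper_splits (X # Xs). sqrt_derivative A ys ** sqrt_derivative A zs))"
  by pat_completeness auto
termination
proof (relation "Wellfounded.measure (\<lambda>(A, Xs). length Xs)")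
  fix A X :: "real^'r^'r" and Xs p ys zs
  assume "p \<in> set (proper_splits (X # Xs))" "(ys, zs) = p"
  then have "length ys < length (X # Xs)" "length zs < length (X # Xs)"
    using proper_splits_length[of ys zs "X # Xs"] by (simp_all del: length_greater_0_conv proper_splits.simps)
  then show "((A, ys), A, X # Xs) \<in> Wellfounded.measure (\<lambda>(A, Xs). length Xs)"
    "((A, zs), A, X # Xs) \<in> Wellfounded.measure (\<lambda>(A, Xs). length Xs)" by simp_all
qed simp

declare sqrt_derivative.simps(2) [simp del]

lemma sqrt_derivative_nonempty:
  assumes "Xs \<noteq> []"
  shows "sqrt_derivative A Xs = sylvester (principal_sqrt A)
    ((if length Xs = 1 then hd Xs else 0) - leibniz (sqrt_derivative A) (sqrt_derivative A) Xs)"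
  using assms by (cases Xs) (auto simp: sqrt_derivative.simps(2) leibniz_def)

lemma sqrt_derivative_singleton: "sqrt_derivative A [X] = sylvester (principal_sqrt A) X"
  by (simp add: sqrt_derivative_nonempty)

lemma multilinear_sqrt_derivative:
  fixes A :: "real^'r^'r"
  assumes "A \<in> posdef_matrices"
  shows "linear (\<lambda>X. sqrt_derivative A (us @ X # vs))"
proof -
  have lin: "linear (sylvester (principal_sqrt A))"
    by (rule linear_sylvester[OF principal_sqrt_posdef[OF assms]])
  have "multilinear_upto n (sqrt_derivative A)" for n
  proof (induction n)
    case (Suc n)
    show ?case unfolding multilinear_upto_def
    proof (intro allI impI)
      fix us vs :: "(real^'r^'r) list" assume "length us + length vs < Suc n"
      then have "linear (\<lambda>X. leibniz (sqrt_derivative A) (sqrt_derivative A) (us @ X # vs))"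
        by (simp add: linear_leibniz[OF Suc Suc])
      moreover have "linear (\<lambda>X. if length (us @ X # vs) = 1 then hd (us @ X # vs) else 0)"
        by (cases us; cases vs) (auto simp: linear_zero linear_ident)
      ultimately have "linear (\<lambda>X. (if length (us @ X # vs) = 1 then hd (us @ X # vs) else 0)
           - leibniz (sqrt_derivative A) (sqrt_derivative A) (us @ X # vs))"
        by (simp only: linear_compose_sub)
      from linear_compose[OF this lin] show "linear (\<lambda>X. sqrt_derivative A (us @ X # vs))"
        by (simp add: sqrt_derivative_nonempty o_def)
    qed
  qed (simp add: multilinear_upto_def)
  then show ?thesis using less_Suc_eq multilinear_upto_def by blast
qed

lemma sqrt_derivative_symmetric:
  assumes A: "A \<in> posdef_matrices" and "set Xs \<subseteq> symmetric_matrices"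
  shows "sqrt_derivative A Xs \<in> symmetric_matrices"
  using assms(2)
proof (induction Xs rule: length_induct)
  case (1 Xs)
  let ?G = "sqrt_derivative A"
  show ?case
  proof (cases "Xs = []")
    case True
    then show ?thesis by (simp add: posdef_symmetric principal_sqrt_posdef A)
  next
    case False
    have "leibniz ?G ?G Xs \<in> symmetric_matrices"
    proof (rule leibniz_symmetric)
      fix ys zs assume s: "(ys, zs) \<in> set (proper_splits Xs)"
      show "?G ys \<in> symmetric_matrices \<and> ?G zs \<in> symmetric_matrices"
        using "1.IH"[rule_format, of ys] "1.IH"[rule_format, of zs] "1.prems"
          proper_splits_length[OF s] proper_splits_set[OF s] by auto
    qed
    moreover have "(if length Xs = 1 then hd Xs else 0) \<in> symmetric_matrices"
      using False "1.prems" subspace_0[OF subspace_symmetric_matrices] by (cases Xs) auto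
    ultimately show ?thesis
      unfolding sqrt_derivative_nonempty[OF False]
      by (intro sylvester_symmetric principal_sqrt_posdef A subspace_diff subspace_symmetric_matrices)
  qed
qed

text \<open>
  The equation that defines the value at \<open>Xs\<close> has a right-hand side built from values at shorter lists,
  which are differentiable by induction. Differentiating it in a direction \<open>H\<close> yields the equation that
  defines the value at \<open>H # Xs\<close>, by \<open>leibniz_Cons\<close>.
\<close>

lemma sqrt_derivative_has_derivative:
  assumes A: "A \<in> posdef_matrices"
  shows "((\<lambda>B. sqrt_derivative B Xs) has_derivative (\<lambda>H. sqrt_derivative A (H # Xs)))
    (at A within posdef_matrices)"
proof (induction Xs rule: length_induct)
  case (1 Xs)
  let ?G = "sqrt_derivative" and ?R = "principal_sqrt A"
  show ?case
  proof (cases "Xs = []")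
    case True
    then show ?thesis by (simp add: sqrt_derivative_singleton principal_sqrt_has_derivative A)
  next
    case False
    define c where "c = (if length Xs = 1 then hd Xs else 0)"
    have "((\<lambda>B. leibniz (?G B) (?G B) Xs) has_derivative
        (\<lambda>H. leibniz (\<lambda>ys. ?G A (H # ys)) (?G A) Xs + leibniz (?G A) (\<lambda>zs. ?G A (H # zs)) Xs))
        (at A within posdef_matrices)" (is "(_ has_derivative ?D) _")
    proof (rule has_derivative_leibniz)
      fix ys zs assume "(ys, zs) \<in> set (proper_splits Xs)"
      then have "length ys < length Xs" "length zs < length Xs"
        using proper_splits_length[of ys zs Xs] by (simp_all del: length_greater_0_conv)
      then show "((\<lambda>B. ?G B ys) has_derivative (\<lambda>H. ?G A (H # ys))) (at A within posdef_matrices) \<and>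
          ((\<lambda>B. ?G B zs) has_derivative (\<lambda>H. ?G A (H # zs))) (at A within posdef_matrices)"
        using "1.IH" by blast
    qed
    then have P: "((\<lambda>B. c - leibniz (?G B) (?G B) Xs) has_derivative (\<lambda>H. 0 - ?D H))
        (at A within posdef_matrices)"
      by (intro has_derivative_diff has_derivative_const)
    have eq: "principal_sqrt B ** ?G B Xs + ?G B Xs ** principal_sqrt B = c - leibniz (?G B) (?G B) Xs"
      if "B \<in> posdef_matrices" for B
      using that by (simp add: sqrt_derivative_nonempty[OF False] c_def sylvester_solves principal_sqrt_posdef)
    have "((\<lambda>B. ?G B Xs) has_derivative (\<lambda>H. sylvester ?R
        (0 - ?D H - sylvester ?R H ** ?G A Xs - ?G A Xs ** sylvester ?R H))) (at A within posdef_matrices)"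
      by (rule sylvester_solution_has_derivative[where F = "\<lambda>B. ?G B Xs", OF principal_sqrt_has_derivative[OF A] P
            eq A principal_sqrt_posdef[OF A]])
    moreover have "sylvester ?R (0 - ?D H - sylvester ?R H ** ?G A Xs - ?G A Xs ** sylvester ?R H) = ?G A (H # Xs)" for H
    proof -
      have "0 - ?D H - sylvester ?R H ** ?G A Xs - ?G A Xs ** sylvester ?R H =
          (if length (H # Xs) = 1 then hd (H # Xs) else 0) - leibniz (?G A) (?G A) (H # Xs)"
        using False by (simp add: leibniz_Cons sqrt_derivative_singleton algebra_simps)
      then show ?thesis by (simp only: sqrt_derivative_nonempty[of "H # Xs"] list.distinct not_False_eq_True)
    qed
    ultimately show ?thesis by simp
  qed
qed

lemma leibniz_sqrt_derivative_symmetric: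
  assumes "A \<in> posdef_matrices" "set Xs \<subseteq> symmetric_matrices"
  shows "leibniz (sqrt_derivative A) (sqrt_derivative A) Xs \<in> symmetric_matrices"
  using assms proper_splits_set[of _ _ Xs]
  by (intro leibniz_symmetric) (blast intro: sqrt_derivative_symmetric order_trans)

lemma sqrt_derivative_replicate:
  assumes "n \<ge> 2"
  shows "sqrt_derivative A (replicate n H) = sylvester (principal_sqrt A)
    (- leibniz (sqrt_derivative A) (sqrt_derivative A) (replicate n H))"
  using assms by (subst sqrt_derivative_nonempty) auto

section \<open>Uniform bounds for multilinear maps\<close>

text \<open>
  The sum of \<open>norm (T bs)\<close> over all lists \<open>bs\<close> of \<open>n\<close> basis vectors.
\<close>

primrec basis_norm_sum :: "nat \<Rightarrow> ('a::euclidean_space list \<Rightarrow> 'b::real_normed_vector) \<Rightarrow> real" where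
  "basis_norm_sum 0 T = norm (T [])"
| "basis_norm_sum (Suc n) T = (\<Sum>b\<in>Basis. basis_norm_sum n (\<lambda>bs. T (b # bs)))"

lemma basis_norm_sum_nonneg: "0 \<le> basis_norm_sum n T"
  by (induction n arbitrary: T) (auto intro: sum_nonneg)

lemma prod_list_map_nonneg: "(\<And>x. x \<in> set xs \<Longrightarrow> 0 \<le> f x) \<Longrightarrow> 0 \<le> (\<Prod>x\<leftarrow>xs. f x :: real)"
  by (induction xs) auto

text \<open>
  Expand each slot in the standard basis; the coordinates of a vector are bounded by its norm.
\<close>

lemma multilinear_norm_bound:
  fixes T :: "'a::euclidean_space list \<Rightarrow> 'b::real_normed_vector"
  assumes "\<And>us vs. linear (\<lambda>X. T (us @ X # vs))"
  shows "norm (T Xs) \<le> basis_norm_sum (length Xs) T * (\<Prod>X\<leftarrow>Xs. norm X)"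
  using assms
proof (induction Xs arbitrary: T)
  case (Cons X Xs)
  let ?P = "\<Prod>X\<leftarrow>Xs. norm X"
  have P: "0 \<le> ?P" by (rule prod_list_map_nonneg) simp
  have lin: "linear (\<lambda>X. T (X # Xs))" using Cons.prems[of "[]"] by simp
  have IH: "norm (T (b # Xs)) \<le> basis_norm_sum (length Xs) (\<lambda>bs. T (b # bs)) * ?P" for b
    using Cons.IH[of "\<lambda>bs. T (b # bs)"] Cons.prems[of "b # _"] by simp
  have "T (X # Xs) = (\<Sum>b\<in>Basis. (X \<bullet> b) *\<^sub>R T (b # Xs))"
    using linear_sum[OF lin, of "\<lambda>b. (X \<bullet> b) *\<^sub>R b" Basis]
    by (simp add: euclidean_representation linear_scale[OF lin])
  then have "norm (T (X # Xs)) \<le> (\<Sum>b\<in>Basis. \<bar>X \<bullet> b\<bar> * norm (T (b # Xs)))"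
    by (simp add: order_trans[OF norm_sum])
  also have "\<dots> \<le> (\<Sum>b\<in>Basis. norm X * (basis_norm_sum (length Xs) (\<lambda>bs. T (b # bs)) * ?P))"
    by (intro sum_mono mult_mono IH) (auto simp: Basis_le_norm)
  finally show ?case
    by (simp add: sum_distrib_right sum_distrib_left mult_ac)
qed simp

lemma tendsto_basis_norm_sum:
  assumes "\<And>bs. length bs = n \<Longrightarrow> ((\<lambda>x. T x bs) \<longlongrightarrow> 0) F"
  shows "((\<lambda>x. basis_norm_sum n (T x)) \<longlongrightarrow> 0) F"
  using assms
proof (induction n arbitrary: T)
  case (Suc n)
  have "((\<lambda>x. basis_norm_sum n (\<lambda>bs. T x (b # bs))) \<longlongrightarrow> 0) F" for b
    using Suc.prems by (intro Suc.IH) simp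
  then show ?case by (auto intro!: tendsto_null_sum)
qed (simp add: tendsto_norm_zero)

text \<open>
  A multilinear map on a finite-dimensional space is controlled by its finitely many values on basis
  vectors, so pointwise convergence is uniform. This turns derivatives for fixed directions into
  derivatives with respect to the operator norm.
\<close>

lemma multilinear_tendsto_uniform:
  fixes T :: "'c \<Rightarrow> 'a::euclidean_space list \<Rightarrow> 'b::real_normed_vector"
  assumes lin: "\<forall>\<^sub>F x in F. \<forall>us vs. linear (\<lambda>X. T x (us @ X # vs))"
    and lim: "\<And>bs. length bs = n \<Longrightarrow> ((\<lambda>x. T x bs) \<longlongrightarrow> 0) F" and "e > 0"
  shows "\<forall>\<^sub>F x in F. \<forall>Xs. length Xs = n \<longrightarrow> norm (T x Xs) \<le> e * (\<Prod>X\<leftarrow>Xs. norm X)"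
proof -
  have "\<forall>\<^sub>F x in F. dist (basis_norm_sum n (T x)) 0 < e"
    using tendsto_basis_norm_sum[OF lim] \<open>e > 0\<close> by (rule tendstoD)
  with lin show ?thesis
  proof eventually_elim
    case (elim x)
    show ?case
    proof (intro allI impI)
      fix Xs :: "'a list" assume n: "length Xs = n"
      have "norm (T x Xs) \<le> basis_norm_sum (length Xs) (T x) * (\<Prod>X\<leftarrow>Xs. norm X)"
        using elim(1) by (intro multilinear_norm_bound) blast
      also have "\<dots> \<le> e * (\<Prod>X\<leftarrow>Xs. norm X)"
        using elim(2) n by (intro mult_right_mono prod_list_map_nonneg) auto
      finally show "norm (T x Xs) \<le> e * (\<Prod>X\<leftarrow>Xs. norm X)" .
    qed
  qed
qed

section \<open>Iterated Frechet derivatives\<close>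

lemma posdef_add_small:
  assumes "A \<in> posdef_matrices" "H \<in> symmetric_matrices" "norm H < lambda_min A"
  shows "A + H \<in> posdef_matrices"
proof -
  have "coercive (lambda_min A - norm H) (A + H)"
    using coercive_perturb[OF coercive_lambda_min[OF posdef_symmetric[OF assms(1)]], of "A + H"] by simp
  then show ?thesis
    using assms posdef_symmetric[OF assms(1)] subspace_add[OF subspace_symmetric_matrices]
    by (auto simp: posdef_iff intro!: exI[of _ "lambda_min A - norm H"])
qed

text \<open>
  Differentiability does not distinguish equivalent norms. \<open>N\<close> is constrained on symmetric matrices
  only, because the formulas for the two norms of interest are not norms elsewhere.
\<close>

locale symmetric_norm =
  fixes N :: "real^'r^'r \<Rightarrow> real" and c C :: real
  assumes c_pos: "c > 0" and C_pos: "C > 0"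
    and lower: "\<And>X. X \<in> symmetric_matrices \<Longrightarrow> c * norm X \<le> N X"
    and upper: "\<And>X. X \<in> symmetric_matrices \<Longrightarrow> N X \<le> C * norm X"
begin

lemma N_nonneg: "X \<in> symmetric_matrices \<Longrightarrow> 0 \<le> N X"
  using lower[of X] c_pos by (meson mult_nonneg_nonneg norm_ge_zero less_imp_le order_trans)

lemma N_zero: "N 0 = 0"
  using lower[OF subspace_0[OF subspace_symmetric_matrices]]
    upper[OF subspace_0[OF subspace_symmetric_matrices]] by simp

lemma prod_N_nonneg: "set Xs \<subseteq> symmetric_matrices \<Longrightarrow> 0 \<le> (\<Prod>X\<leftarrow>Xs. N X)"
  by (rule prod_list_map_nonneg) (auto intro: N_nonneg)

lemma prod_norm_le:
  "set Xs \<subseteq> symmetric_matrices \<Longrightarrow> c ^ length Xs * (\<Prod>X\<leftarrow>Xs. norm X) \<le> (\<Prod>X\<leftarrow>Xs. N X)"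
proof (induction Xs)
  case (Cons X Xs)
  then have "(c * norm X) * (c ^ length Xs * (\<Prod>X\<leftarrow>Xs. norm X)) \<le> N X * (\<Prod>X\<leftarrow>Xs. N X)"
    using c_pos lower by (intro mult_mono mult_nonneg_nonneg N_nonneg prod_list_map_nonneg) auto
  then show ?case by (simp add: mult_ac)
qed simp

text \<open>
  Changing from the Euclidean norm to \<open>N\<close> costs a factor \<open>c\<close> in each slot and a factor \<open>C\<close> for the value.
\<close>

lemma N_le_prod:
  assumes "X \<in> symmetric_matrices" "set Xs \<subseteq> symmetric_matrices" "0 \<le> e"
    and "norm X \<le> e * c ^ length Xs / C * (\<Prod>X\<leftarrow>Xs. norm X)"
  shows "N X \<le> e * (\<Prod>X\<leftarrow>Xs. N X)"
proof -
  have "N X \<le> C * norm X" by (rule upper[OF assms(1)])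
  also have "\<dots> \<le> e * (c ^ length Xs * (\<Prod>X\<leftarrow>Xs. norm X))"
    using assms(4) C_pos by (simp add: field_simps)
  also have "\<dots> \<le> e * (\<Prod>X\<leftarrow>Xs. N X)"
    by (intro mult_left_mono prod_norm_le assms)
  finally show ?thesis .
qed

lemma bounded_multilinear_sqrt_derivative:
  assumes A: "A \<in> posdef_matrices"
  shows "bounded_multilinear N n (sqrt_derivative A)"
  unfolding bounded_multilinear_def
proof (intro conjI ballI allI impI)
  fix Xs :: "(real^'r^'r) list" assume Xs: "Xs \<in> directions n"
  then show "sqrt_derivative A Xs \<in> symmetric_matrices"
    by (intro sqrt_derivative_symmetric A) (simp add: directions_def)
  fix i Y Z and a b :: real assume "i < n"
  then have upd: "Xs[i := W] = take i Xs @ W # drop (Suc i) Xs" for W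
    using Xs by (simp add: directions_def upd_conv_take_nth_drop)
  have lin: "linear (\<lambda>W. sqrt_derivative A (Xs[i := W]))"
    unfolding upd by (rule multilinear_sqrt_derivative[OF A])
  show "sqrt_derivative A (Xs[i := a *\<^sub>R Y + b *\<^sub>R Z]) =
      a *\<^sub>R sqrt_derivative A (Xs[i := Y]) + b *\<^sub>R sqrt_derivative A (Xs[i := Z])"
    by (simp only: linear_add[OF lin] linear_scale[OF lin])
next
  let ?K = "basis_norm_sum n (sqrt_derivative A)"
  define B where "B = C * ?K / c ^ n"
  have "N (sqrt_derivative A Xs) \<le> B * (\<Prod>X\<leftarrow>Xs. N X)" if "Xs \<in> directions n" for Xs
  proof (rule N_le_prod)
    show "norm (sqrt_derivative A Xs) \<le> B * c ^ length Xs / C * (\<Prod>X\<leftarrow>Xs. norm X)"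
      using multilinear_norm_bound[of "sqrt_derivative A" Xs] multilinear_sqrt_derivative[OF A] that
        C_pos c_pos by (simp add: B_def directions_def)
    show "0 \<le> B" using C_pos c_pos by (simp add: B_def basis_norm_sum_nonneg)
  qed (use that A in \<open>auto simp: directions_def intro: sqrt_derivative_symmetric\<close>)
  then show "\<exists>B. \<forall>Xs\<in>directions n. N (sqrt_derivative A Xs) \<le> B * (\<Prod>X\<leftarrow>Xs. N X)" by blast
qed

text \<open>
  The difference quotient of \<open>B \<mapsto> sqrt_derivative B Xs\<close>, including the linear correction, is multilinear
  in \<open>Xs\<close> and tends to zero for each \<open>Xs\<close>.
\<close>

lemma has_frechet_derivative_sqrt_derivative:
  assumes A: "A \<in> posdef_matrices"
  shows "has_frechet_derivative_at N posdef_matrices n sqrt_derivative A (sqrt_derivative A)"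
  unfolding has_frechet_derivative_at_def
proof (intro conjI allI impI bounded_multilinear_sqrt_derivative A)
  let ?G = "sqrt_derivative"
  fix e :: real assume e: "e > 0"
  \<comment> \<open>the increment \<open>H\<close> counts as one more slot in \<open>N_le_prod\<close>\<close>
  define e' where "e' = e * c ^ Suc n / C"
  have e': "e' > 0" using e c_pos C_pos by (simp add: e'_def)
  define T where "T B Xs = (?G B Xs - ?G A Xs - ?G A ((B - A) # Xs)) /\<^sub>R norm (B - A)" for B Xs
  have "\<forall>\<^sub>F B in at A within posdef_matrices. \<forall>us vs. linear (\<lambda>X. T B (us @ X # vs))"
    using eventually_in_at_within
  proof eventually_elim
    case (elim B)
    show ?case unfolding T_def
      using multilinear_sqrt_derivative[OF A, of "(B - A) # _"]
      by (auto intro!: linear_compose_scale_right linear_compose_sub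
          multilinear_sqrt_derivative A elim)
  qed
  moreover have "((\<lambda>B. T B Xs) \<longlongrightarrow> 0) (at A within posdef_matrices)" for Xs
    using sqrt_derivative_has_derivative[OF A, of Xs] by (simp add: T_def has_derivative_at_within)
  ultimately have "\<forall>\<^sub>F B in at A within posdef_matrices.
      \<forall>Xs. length Xs = n \<longrightarrow> norm (T B Xs) \<le> e' * (\<Prod>X\<leftarrow>Xs. norm X)"
    using e' by (rule multilinear_tendsto_uniform)
  then obtain d where d: "d > 0" and bound: "\<And>B Xs. \<lbrakk>B \<in> posdef_matrices; B \<noteq> A; dist B A < d; length Xs = n\<rbrakk>
      \<Longrightarrow> norm (T B Xs) \<le> e' * (\<Prod>X\<leftarrow>Xs. norm X)"
    unfolding eventually_at by blast
  have "N (?G (A + H) Xs - ?G A Xs - ?G A (H # Xs)) \<le> e * N H * (\<Prod>X\<leftarrow>Xs. N X)"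
    if H: "H \<in> symmetric_matrices" "N H < c * d" "A + H \<in> posdef_matrices" and Xs: "Xs \<in> directions n" for H Xs
  proof (cases "H = 0")
    case True
    have "?G A (0 # Xs) = 0"
      using linear_0[OF multilinear_sqrt_derivative[OF A, of "[]" Xs]] by simp
    then show ?thesis by (simp add: True N_zero)
  next
    case False
    let ?E = "?G (A + H) Xs - ?G A Xs - ?G A (H # Xs)"
    have sets: "set Xs \<subseteq> symmetric_matrices" "length Xs = n" using Xs by (auto simp: directions_def)
    have "c * norm H < c * d" using lower[OF H(1)] H(2) by simp
    then have "norm (T (A + H) Xs) \<le> e' * (\<Prod>X\<leftarrow>Xs. norm X)"
      using c_pos False sets H(3) by (intro bound) (auto simp: dist_norm)
    moreover have "norm (T (A + H) Xs) = norm ?E / norm H"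
      unfolding T_def by (simp only: norm_scaleR add_diff_cancel_left') (simp add: divide_inverse)
    ultimately have "norm ?E \<le> e' * (\<Prod>X\<leftarrow>H # Xs. norm X)"
      using False by (simp add: pos_divide_le_eq mult_ac)
    moreover have "?E \<in> symmetric_matrices"
      using sets H A by (intro subspace_diff subspace_symmetric_matrices sqrt_derivative_symmetric) auto
    ultimately have "N ?E \<le> e * (\<Prod>X\<leftarrow>H # Xs. N X)"
      using e sets H by (intro N_le_prod) (auto simp: e'_def)
    then show ?thesis by (simp add: mult_ac)
  qed
  then show "\<exists>d>0. \<forall>H\<in>symmetric_matrices. N H < d \<longrightarrow> A + H \<in> posdef_matrices \<longrightarrow>
      (\<forall>Xs\<in>directions n. N (?G (A + H) Xs - ?G A Xs - ?G A (H # Xs)) \<le> e * N H * (\<Prod>X\<leftarrow>Xs. N X))"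
    using d c_pos by (intro exI[of _ "c * d"]) auto
qed

lemma bounded_multilinear_scale_head:
  assumes "bounded_multilinear N (Suc n) L" "H \<in> symmetric_matrices" "Xs \<in> directions n"
  shows "L ((t *\<^sub>R H) # Xs) = t *\<^sub>R L (H # Xs)"
proof -
  have "H # Xs \<in> directions (Suc n)" using assms by (auto simp: directions_def)
  then have "L ((H # Xs)[0 := t *\<^sub>R H + 0 *\<^sub>R H]) = t *\<^sub>R L ((H # Xs)[0 := H]) + 0 *\<^sub>R L ((H # Xs)[0 := H])"
    using assms(1,2) unfolding bounded_multilinear_def by blast
  then show ?thesis by simp
qed

text \<open>
  If \<open>L\<close> and \<open>M\<close> are both derivatives then their difference is \<open>o (N K)\<close> along \<open>K = t *\<^sub>R H\<close>, but it is
  linear in \<open>t\<close>. Small multiples of every symmetric \<open>H\<close> are admissible because the positive definite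
  matrices are relatively open.
\<close>

lemma frechet_derivative_unique:
  assumes A: "A \<in> posdef_matrices"
    and G: "\<And>B Xs. B \<in> posdef_matrices \<Longrightarrow> Xs \<in> directions n \<Longrightarrow> G B Xs \<in> symmetric_matrices"
    and L: "has_frechet_derivative_at N posdef_matrices n G A L"
    and M: "has_frechet_derivative_at N posdef_matrices n G A M"
    and Xs: "Xs \<in> directions (Suc n)"
  shows "L Xs = M Xs"
proof (rule ccontr)
  assume neq: "L Xs \<noteq> M Xs"
  obtain H Ys where Xs_eq: "Xs = H # Ys" and H: "H \<in> symmetric_matrices" and Ys: "Ys \<in> directions n"
    using Xs by (cases Xs) (auto simp: directions_def)
  define D where "D = L (H # Ys) - M (H # Ys)"
  define P where "P = (\<Prod>X\<leftarrow>Ys. N X)"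
  have P: "P \<ge> 0" using Ys by (auto simp: P_def directions_def intro: prod_N_nonneg)
  define Q where "Q = C * norm H * P + 1"
  define e where "e = c * norm D / (2 * Q)"
  have pos: "Q > 0" using C_pos P by (simp add: Q_def add_nonneg_pos)
  have D: "norm D > 0" using neq by (simp add: D_def Xs_eq)
  then have e: "e > 0" using c_pos pos by (simp add: e_def)
  obtain d1 where d1: "d1 > 0" "\<And>K. \<lbrakk>K \<in> symmetric_matrices; N K < d1; A + K \<in> posdef_matrices\<rbrakk> \<Longrightarrow>
      N (G (A + K) Ys - G A Ys - L (K # Ys)) \<le> e * N K * P"
    using L e Ys unfolding has_frechet_derivative_at_def P_def by metis
  obtain d2 where d2: "d2 > 0" "\<And>K. \<lbrakk>K \<in> symmetric_matrices; N K < d2; A + K \<in> posdef_matrices\<rbrakk> \<Longrightarrow>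
      N (G (A + K) Ys - G A Ys - M (K # Ys)) \<le> e * N K * P"
    using M e Ys unfolding has_frechet_derivative_at_def P_def by metis
  have bm: "bounded_multilinear N (Suc n) L" "bounded_multilinear N (Suc n) M"
    using L M by (auto simp: has_frechet_derivative_at_def)
  \<comment> \<open>a multiple of \<open>H\<close> that keeps \<open>A + K\<close> positive definite and satisfies both estimates\<close>
  define s where "s = min (lambda_min A) (min (d1 / C) (d2 / C))"
  have s: "s > 0" using lambda_min_pos[OF A] d1 d2 C_pos by (simp add: s_def)
  define t where "t = s / (norm H + 1)"
  have t: "t > 0" using s by (simp add: t_def add_nonneg_pos)
  define K where "K = t *\<^sub>R H"
  have K: "K \<in> symmetric_matrices" unfolding K_def by (intro subspace_scale subspace_symmetric_matrices H)
  have "norm K = s * (norm H / (norm H + 1))" using s by (simp add: K_def t_def)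
  also have "\<dots> < s * 1" using s by (intro mult_strict_left_mono) (simp_all add: divide_simps add_nonneg_pos)
  finally have Ks: "norm K < s" by simp
  then have "norm K < lambda_min A" "norm K < d1 / C" "norm K < d2 / C" by (simp_all add: s_def)
  then have AK: "A + K \<in> posdef_matrices" and "C * norm K < d1" "C * norm K < d2"
    using C_pos by (auto intro: posdef_add_small[OF A K] simp: field_simps)
  then have NK: "N K < d1" "N K < d2" using upper[OF K] by simp_all
  let ?E = "\<lambda>L. G (A + K) Ys - G A Ys - L (K # Ys)"
  have "K # Ys \<in> directions (Suc n)" using K Ys by (auto simp: directions_def)
  then have sym: "?E L \<in> symmetric_matrices" "?E M \<in> symmetric_matrices"
    using bm G[OF AK Ys] G[OF A Ys] unfolding bounded_multilinear_def
    by (auto intro!: subspace_diff subspace_symmetric_matrices)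
  have bnd: "c * norm (?E L) \<le> e * (C * norm K) * P" "c * norm (?E M) \<le> e * (C * norm K) * P"
  proof -
    have "e * N K * P \<le> e * (C * norm K) * P"
      using e by (intro mult_right_mono mult_left_mono upper K P) simp
    then show "c * norm (?E L) \<le> e * (C * norm K) * P" "c * norm (?E M) \<le> e * (C * norm K) * P"
      using order_trans[OF lower[OF sym(1)] d1(2)[OF K NK(1) AK]]
        order_trans[OF lower[OF sym(2)] d2(2)[OF K NK(2) AK]] by linarith+
  qed
  have "?E M - ?E L = t *\<^sub>R D"
    using bounded_multilinear_scale_head[OF bm(1) H Ys] bounded_multilinear_scale_head[OF bm(2) H Ys]
    by (simp add: K_def D_def scaleR_diff_right)
  then have "t * norm D \<le> norm (?E M) + norm (?E L)"
    using norm_triangle_ineq4[of "?E M" "?E L"] t by simp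
  then have "c * (t * norm D) \<le> c * norm (?E M) + c * norm (?E L)"
    using c_pos by (simp add: distrib_left[symmetric])
  also have "\<dots> \<le> t * (2 * e * (C * norm H * P))"
    using bnd t by (simp add: K_def mult_ac)
  finally have "t * (c * norm D) \<le> t * (2 * e * (C * norm H * P))" by (simp add: mult_ac)
  then have "c * norm D \<le> 2 * e * (C * norm H * P)" using t by simp
  also have "\<dots> < 2 * e * Q" using e by (simp add: Q_def)
  also have "\<dots> = c * norm D" using pos by (simp add: e_def)
  finally show False by simp
qed

lemma has_frechet_derivative_cong:
  assumes "A \<in> U" "\<And>B Xs. B \<in> U \<Longrightarrow> Xs \<in> directions n \<Longrightarrow> F B Xs = G B Xs"
  shows "has_frechet_derivative_at N U n F A L \<longleftrightarrow> has_frechet_derivative_at N U n G A L"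
  using assms unfolding has_frechet_derivative_at_def by (simp cong: ball_cong)

text \<open>
  The derivative selected by \<open>nabla\<close> is an arbitrary one, and its values off \<open>directions n\<close> are arbitrary.
  By uniqueness it agrees with \<open>sqrt_derivative\<close> on \<open>directions n\<close>, which is all that the next
  derivative depends on.
\<close>

lemma nabla_principal_sqrt:
  assumes "A \<in> posdef_matrices" "Xs \<in> directions n"
  shows "nabla N posdef_matrices principal_sqrt n A Xs = sqrt_derivative A Xs"
  using assms
proof (induction n arbitrary: A Xs)
  case 0
  then show ?case by (simp add: directions_def)
next
  case (Suc n)
  have "has_frechet_derivative_at N posdef_matrices n (nabla N posdef_matrices principal_sqrt n) A (sqrt_derivative A)"
    using has_frechet_derivative_sqrt_derivative[OF Suc.prems(1)]
      has_frechet_derivative_cong[OF Suc.prems(1) Suc.IH] by simp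
  then have "has_frechet_derivative_at N posdef_matrices n (nabla N posdef_matrices principal_sqrt n) A
      (nabla N posdef_matrices principal_sqrt (Suc n) A)"
    by (simp add: someI[of "has_frechet_derivative_at _ _ _ _ _"])
  then have "has_frechet_derivative_at N posdef_matrices n sqrt_derivative A
      (nabla N posdef_matrices principal_sqrt (Suc n) A)"
    using has_frechet_derivative_cong[OF Suc.prems(1) Suc.IH] by simp
  then show ?case
    using has_frechet_derivative_sqrt_derivative[OF Suc.prems(1)]
    by (intro frechet_derivative_unique[of A n sqrt_derivative])
      (use Suc.prems in \<open>auto simp: directions_def intro: sqrt_derivative_symmetric\<close>)
qed

lemma principal_sqrt_differentiable_any_order:
  "frechet_differentiable_any_order_on N posdef_matrices principal_sqrt"
  unfolding frechet_differentiable_any_order_on_def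
proof (intro allI conjI ballI)
  fix n and A :: "real^'r^'r" assume A: "A \<in> posdef_matrices"
  show "\<exists>L. has_frechet_derivative_at N posdef_matrices n (nabla N posdef_matrices principal_sqrt n) A L"
    using has_frechet_derivative_sqrt_derivative[OF A, of n]
      has_frechet_derivative_cong[OF A, of n "nabla N posdef_matrices principal_sqrt n" sqrt_derivative]
      nabla_principal_sqrt by blast
next
  fix n
  show "multilinear_continuous_on N posdef_matrices (Suc n) (nabla N posdef_matrices principal_sqrt (Suc n))"
    unfolding multilinear_continuous_on_def
  proof (intro ballI allI impI)
    fix A :: "real^'r^'r" and e :: real assume A: "A \<in> posdef_matrices" and e: "e > 0"
    let ?G = "sqrt_derivative"
    define e' where "e' = e * c ^ Suc n / C"
    have e': "e' > 0" using e c_pos C_pos by (simp add: e'_def)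
    have "\<forall>\<^sub>F B in at A within posdef_matrices. \<forall>us vs. linear (\<lambda>X. ?G B (us @ X # vs) - ?G A (us @ X # vs))"
      using eventually_in_at_within
      by eventually_elim (auto intro!: linear_compose_sub multilinear_sqrt_derivative A)
    moreover have "((\<lambda>B. ?G B Xs - ?G A Xs) \<longlongrightarrow> 0) (at A within posdef_matrices)" for Xs
      using has_derivative_continuous[OF sqrt_derivative_has_derivative[OF A, of Xs]]
      by (simp add: continuous_within LIM_zero)
    ultimately have "\<forall>\<^sub>F B in at A within posdef_matrices.
        \<forall>Xs. length Xs = Suc n \<longrightarrow> norm (?G B Xs - ?G A Xs) \<le> e' * (\<Prod>X\<leftarrow>Xs. norm X)"
      using e' by (rule multilinear_tendsto_uniform)
    then obtain d where d: "d > 0" and bound: "\<And>B Xs. \<lbrakk>B \<in> posdef_matrices; B \<noteq> A; dist B A < d; length Xs = Suc n\<rbrakk>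
        \<Longrightarrow> norm (?G B Xs - ?G A Xs) \<le> e' * (\<Prod>X\<leftarrow>Xs. norm X)"
      unfolding eventually_at by blast
    have "N (nabla N posdef_matrices principal_sqrt (Suc n) B Xs - nabla N posdef_matrices principal_sqrt (Suc n) A Xs)
        \<le> e * (\<Prod>X\<leftarrow>Xs. N X)"
      if B: "B \<in> posdef_matrices" "N (B - A) < c * d" and Xs: "Xs \<in> directions (Suc n)" for B Xs
    proof -
      have sets: "set Xs \<subseteq> symmetric_matrices" "length Xs = Suc n" using Xs by (auto simp: directions_def)
      have "c * norm (B - A) < c * d"
        using lower[of "B - A"] B A posdef_symmetric subspace_diff[OF subspace_symmetric_matrices]
        by (metis order_le_less_trans)
      then have "norm (?G B Xs - ?G A Xs) \<le> e' * (\<Prod>X\<leftarrow>Xs. norm X)"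
        using c_pos sets B(1) e' bound[of B Xs]
        by (cases "B = A") (auto simp: dist_norm intro!: mult_nonneg_nonneg prod_list_map_nonneg)
      then have "N (?G B Xs - ?G A Xs) \<le> e * (\<Prod>X\<leftarrow>Xs. N X)"
        using e sets A B(1)
        by (intro N_le_prod)
          (auto simp: e'_def intro!: subspace_diff subspace_symmetric_matrices sqrt_derivative_symmetric)
      then show ?thesis by (simp only: nabla_principal_sqrt[OF A Xs] nabla_principal_sqrt[OF B(1) Xs])
    qed
    then show "\<exists>d>0. \<forall>B\<in>posdef_matrices. N (B - A) < d \<longrightarrow> (\<forall>Xs\<in>directions (Suc n).
        N (nabla N posdef_matrices principal_sqrt (Suc n) B Xs - nabla N posdef_matrices principal_sqrt (Suc n) A Xs)
        \<le> e * (\<Prod>X\<leftarrow>Xs. N X))"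
      using d c_pos by (intro exI[of _ "c * d"]) auto
  qed
qed

lemma nabla_dir_principal_sqrt:
  assumes "A \<in> posdef_matrices" "H \<in> symmetric_matrices"
  shows "nabla_dir N posdef_matrices principal_sqrt n A H = sqrt_derivative A (replicate n H)"
  unfolding nabla_dir_def using assms
  by (intro nabla_principal_sqrt) (auto simp: directions_def set_replicate_conv_if)

end

section \<open>Leibniz sums in a single direction\<close>

text \<open>
  Induction on \<open>n\<close> through \<open>leibniz_Cons\<close>, with Pascal's rule; \<open>f\<close> and \<open>g\<close> vary because one of them
  receives the additional entry.
\<close>

lemma leibniz_replicate:
  "leibniz f g (replicate n x) =
    (\<Sum>k\<in>{1..<n}. real (n choose k) *\<^sub>R (f (replicate k x) ** g (replicate (n - k) x)))"
proof (induction n arbitrary: f g)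
  case (Suc n)
  show ?case
  proof (cases "n = 0")
    case False
    define a where "a k = f (replicate k x) ** g (replicate (Suc n - k) x)" for k
    have split: "{1..<Suc n} = insert n {1..<n}" "{0..<n} = insert 0 {1..<n}"
      using False by auto
    have "(\<Sum>k\<in>{1..<Suc n}. real (Suc n choose k) *\<^sub>R a k) =
        (\<Sum>k\<in>{1..<Suc n}. real (n choose (k - 1)) *\<^sub>R a k) + (\<Sum>k\<in>{1..<Suc n}. real (n choose k) *\<^sub>R a k)"
      unfolding sum.distrib[symmetric]
    proof (intro sum.cong refl)
      fix k assume "k \<in> {1..<Suc n}"
      then obtain j where "k = Suc j" by (cases k) auto
      then show "real (Suc n choose k) *\<^sub>R a k = real (n choose (k - 1)) *\<^sub>R a k + real (n choose k) *\<^sub>R a k"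
        by (simp add: scaleR_add_left)
    qed
    also have "(\<Sum>k\<in>{1..<Suc n}. real (n choose (k - 1)) *\<^sub>R a k) = (\<Sum>k\<in>{0..<n}. real (n choose k) *\<^sub>R a (Suc k))"
      by (rule sum.reindex_bij_witness[of _ Suc "\<lambda>k. k - 1"]) auto
    also have "\<dots> = a 1 + (\<Sum>k\<in>{1..<n}. real (n choose k) *\<^sub>R a (Suc k))"
      using False by (simp add: split(2))
    also have "(\<Sum>k\<in>{1..<Suc n}. real (n choose k) *\<^sub>R a k) = a n + (\<Sum>k\<in>{1..<n}. real (n choose k) *\<^sub>R a k)"
      using False by (simp add: split(1))
    also have "(\<Sum>k\<in>{1..<n}. real (n choose k) *\<^sub>R a k) =
        (\<Sum>k\<in>{1..<n}. real (n choose k) *\<^sub>R (f (replicate k x) ** g (x # replicate (n - k) x)))"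
      by (intro sum.cong) (auto simp: a_def Suc_diff_le)
    finally show ?thesis
      using False by (simp add: leibniz_Cons Suc.IH a_def)
  qed simp
qed simp

lemma leibniz_replicate_factorial:
  assumes "n \<ge> 2"
  shows "leibniz f g (replicate n x) =
    (\<Sum>(p, q)\<in>{(p, q). p + q = n - 2}. (fact n / (fact (p + 1) * fact (q + 1))) *\<^sub>R
      (f (replicate (p + 1) x) ** g (replicate (q + 1) x)))"
  unfolding leibniz_replicate
proof (rule sum.reindex_bij_witness[of _ "\<lambda>(p, q). p + 1" "\<lambda>k. (k - 1, n - k - 1)"])
  fix k assume "k \<in> {1..<n}"
  then obtain p q where k: "k = Suc p" and n: "n = Suc p + Suc q"
    by (metis Suc_le_D atLeastLessThan_iff One_nat_def less_imp_Suc_add add_Suc_right)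
  show "(case (k - 1, n - k - 1) of (p, q) \<Rightarrow> (fact n / (fact (p + 1) * fact (q + 1))) *\<^sub>R
      (f (replicate (p + 1) x) ** g (replicate (q + 1) x)))
      = real (n choose k) *\<^sub>R (f (replicate k x) ** g (replicate (n - k) x))"
    unfolding k n using binomial_fact[of "Suc p" "Suc p + Suc q", where 'a = real]
    by (simp del: binomial_Suc_Suc fact_Suc replicate_Suc add: Suc_diff_le)
qed (use assms in auto)

section \<open>The Catalan recurrence\<close>

lemma catalan_0: "catalan 0 = 1"
  by (simp add: catalan_def)

lemma catalan_nonneg: "catalan n \<ge> 0"
  by (simp add: catalan_def)

lemma catalan_Suc_ratio: "catalan (Suc n) * (real n + 2) = catalan n * (2 * (2 * real n + 1))"
proof -
  have cat: "catalan k = fact (2 * k) / (fact k * fact k) / (real k + 1)" for k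
    using binomial_fact[of k "2 * k", where 'a = real] by (simp add: catalan_def mult_2)
  have fact_double: "fact (2 * Suc n) = (2 * real n + 2) * ((2 * real n + 1) * fact (2 * n))"
    by (simp add: algebra_simps)
  have "(2 * x + 2) * ((2 * x + 1) * a) / (((x + 1) * b) * ((x + 1) * b)) / (x + 2) * (x + 2) =
      a / (b * b) / (x + 1) * (2 * (2 * x + 1))" if "x \<ge> 0" "b > 0" for x a b :: real
  proof -
    have "x + 1 \<noteq> 0" "x + 2 \<noteq> 0" using that by auto
    then show ?thesis using that by (simp add: divide_simps) (simp add: algebra_simps)
  qed
  from this[of "real n" "fact n" "fact (2 * n)"] show ?thesis
    unfolding cat fact_double by (simp add: add_ac)
qed

text \<open>
  The Catalan numbers are, up to powers of four and signs, the Taylor coefficients of the scalar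
  square root.
\<close>

lemma gbinomial_half: "(1/2 :: real) gchoose (Suc n) = (-1) ^ n * catalan n * 2 / 4 ^ Suc n"
proof (induction n)
  case (Suc n)
  have "(1/2 :: real) gchoose (Suc (Suc n)) = ((1/2) gchoose (Suc n)) * (1/2 - real (Suc n)) / (real n + 2)"
    by (simp add: gbinomial_prod_rev field_simps)
  also have "\<dots> = - ((-1) ^ n * (catalan n * (2 * (2 * real n + 1))) * 2 / 4 ^ Suc (Suc n)) / (real n + 2)"
  proof -
    have "s * b * 2 / (4 * q) * (1 / 2 - (1 + x)) / d = - (s * (b * (2 * (2 * x + 1))) * 2 / (4 * (4 * q))) / d"
      if "q > 0" "d > 0" for s b q x d :: real
      using that by (simp add: divide_simps) (simp add: algebra_simps)
    from this[of "4 ^ n" "real n + 2" "(-1) ^ n" "catalan n" "real n"] show ?thesis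
      by (simp add: Suc.IH)
  qed
  also have "catalan n * (2 * (2 * real n + 1)) = catalan (Suc n) * (real n + 2)"
    by (simp only: catalan_Suc_ratio)
  also have "- ((-1) ^ n * (catalan (Suc n) * (real n + 2)) * 2 / 4 ^ Suc (Suc n)) / (real n + 2) =
      (-1) ^ Suc n * catalan (Suc n) * 2 / 4 ^ Suc (Suc n)"
    using nonzero_mult_div_cancel_right[of "real n + 2"] by (simp add: mult_ac)
  finally show ?case .
qed (simp add: catalan_0)

text \<open>
  The square of the binomial series of exponent \<open>1/2\<close> is linear, so its coefficient of order
  \<open>n + 2\<close> vanishes. The two extreme terms of this convolution give the left-hand side.
\<close>

lemma catalan_convolution: "catalan (Suc n) = (\<Sum>p\<le>n. catalan p * catalan (n - p))"
proof -
  let ?b = "\<lambda>k. (1/2 :: real) gchoose k"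
  have "0 = ((1/2 + 1/2 :: real) gchoose (Suc (Suc n)))"
    using binomial_gbinomial[of 1 "Suc (Suc n)", where 'a=real] by simp
  also have "\<dots> = (\<Sum>k=0..Suc (Suc n). ?b k * ?b (Suc (Suc n) - k))"
    by (rule gbinomial_Vandermonde[symmetric])
  also have "\<dots> = 2 * ?b (Suc (Suc n)) + (\<Sum>k=1..Suc n. ?b k * ?b (Suc (Suc n) - k))"
    by (simp add: sum.atLeast_Suc_atMost[of 0])
  also have "(\<Sum>k=1..Suc n. ?b k * ?b (Suc (Suc n) - k)) = (\<Sum>p\<le>n. ?b (Suc p) * ?b (Suc (n - p)))"
    by (rule sum.reindex_bij_witness[of _ Suc "\<lambda>k. k - 1"]) (auto simp: Suc_diff_le)
  also have "\<dots> = (\<Sum>p\<le>n. (-1) ^ n * 4 / 4 ^ (n + 2) * (catalan p * catalan (n - p)))"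
  proof (intro sum.cong refl)
    fix p assume "p \<in> {..n}"
    then obtain q where "n = p + q" using le_Suc_ex by auto
    then show "?b (Suc p) * ?b (Suc (n - p)) = (-1) ^ n * 4 / 4 ^ (n + 2) * (catalan p * catalan (n - p))"
      unfolding gbinomial_half by (simp add: power_add)
  qed
  also have "2 * ?b (Suc (Suc n)) = - ((-1) ^ n * 4 / 4 ^ (n + 2) * catalan (Suc n))"
    unfolding gbinomial_half by simp
  finally have "(-1) ^ n * 4 / 4 ^ (n + 2) * catalan (Suc n) =
      (-1) ^ n * 4 / 4 ^ (n + 2) * (\<Sum>p\<le>n. catalan p * catalan (n - p))"
    by (simp add: sum_distrib_left)
  then show ?thesis by simp
qed

section \<open>Taylor expansion along a segment\<close>

text \<open>
  The segment consists of convex combinations of \<open>A\<close> and \<open>A + H\<close>. The contribution of \<open>A + H\<close> is dropped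
  from the lower bound, so that the final estimate depends on \<open>A\<close> alone.
\<close>

lemma posdef_segment:
  assumes "A \<in> posdef_matrices" "H \<in> symmetric_matrices" "A + H \<in> posdef_matrices"
    and t: "t \<in> {0..1}"
  shows coercive_segment: "coercive ((1 - t) * lambda_min A) (A + t *\<^sub>R H)"
    and posdef_on_segment: "A + t *\<^sub>R H \<in> posdef_matrices"
proof -
  let ?m = "(1 - t) * lambda_min A + t * lambda_min (A + H)"
  have eq: "(1 - t) *\<^sub>R A + t *\<^sub>R (A + H) = A + t *\<^sub>R H" by (simp add: algebra_simps)
  have co: "coercive ?m (A + t *\<^sub>R H)"
    using coercive_convex[OF coercive_lambda_min[OF posdef_symmetric[OF assms(1)]]
        coercive_lambda_min[OF posdef_symmetric[OF assms(3)]], of "1 - t" t] t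
    by (simp add: eq)
  have pos: "lambda_min A > 0" "lambda_min (A + H) > 0" using assms lambda_min_pos by auto
  then show "coercive ((1 - t) * lambda_min A) (A + t *\<^sub>R H)"
    using t by (intro coercive_mono[OF co]) simp
  have "?m > 0"
    using pos t by (cases "t = 1") (simp_all add: add_pos_nonneg)
  moreover have "A + t *\<^sub>R H \<in> symmetric_matrices"
    using assms posdef_symmetric
    by (intro subspace_add subspace_scale subspace_symmetric_matrices) auto
  ultimately show "A + t *\<^sub>R H \<in> posdef_matrices"
    using co by (auto simp: posdef_iff)
qed

lemma sqrt_derivative_has_vector_derivative:
  assumes "A \<in> posdef_matrices" "H \<in> symmetric_matrices" "A + H \<in> posdef_matrices"
    and t: "t \<in> {0..1}"
  shows "((\<lambda>s. sqrt_derivative (A + s *\<^sub>R H) Xs) has_vector_derivative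
    sqrt_derivative (A + t *\<^sub>R H) (H # Xs)) (at t within {0..1})"
proof -
  have line: "((\<lambda>s. A + s *\<^sub>R H) has_derivative (\<lambda>h. h *\<^sub>R H)) (at t within {0..1})"
    by (auto intro!: derivative_eq_intros)
  have "(\<lambda>s. A + s *\<^sub>R H) ` {0..1} \<subseteq> posdef_matrices"
    using posdef_on_segment[OF assms(1-3)] by blast
  from has_derivative_in_compose2[where g = "\<lambda>B. sqrt_derivative B Xs",
      OF sqrt_derivative_has_derivative this t line]
  have "((\<lambda>s. sqrt_derivative (A + s *\<^sub>R H) Xs) has_derivative
      (\<lambda>h. sqrt_derivative (A + t *\<^sub>R H) ((h *\<^sub>R H) # Xs))) (at t within {0..1})" .
  moreover have "sqrt_derivative (A + t *\<^sub>R H) ((h *\<^sub>R H) # Xs) = h *\<^sub>R sqrt_derivative (A + t *\<^sub>R H) (H # Xs)" for h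
    using linear_scale[OF multilinear_sqrt_derivative[OF posdef_on_segment[OF assms], of "[]" Xs]] by simp
  ultimately show ?thesis by (simp add: has_vector_derivative_def)
qed

lemma continuous_on_sqrt_derivative_segment:
  assumes "A \<in> posdef_matrices" "H \<in> symmetric_matrices" "A + H \<in> posdef_matrices"
  shows "continuous_on {0..1} (\<lambda>t. sqrt_derivative (A + t *\<^sub>R H) Xs)"
  using sqrt_derivative_has_vector_derivative[OF assms]
  by (rule continuous_on_vector_derivative)

lemma principal_sqrt_Taylor:
  assumes "A \<in> posdef_matrices" "H \<in> symmetric_matrices" "A + H \<in> posdef_matrices"
  shows "principal_sqrt (A + H) = principal_sqrt A
    + (\<Sum>k = 1..n. (1 / fact k) *\<^sub>R sqrt_derivative A (replicate k H))
    + (1 / fact n) *\<^sub>R integral {0..1} (\<lambda>t. (1 - t) ^ n *\<^sub>R sqrt_derivative (A + t *\<^sub>R H) (replicate (Suc n) H))"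
proof -
  have "principal_sqrt (A + 1 *\<^sub>R H) = (\<Sum>i<Suc n. ((1 - 0) ^ i / fact i) *\<^sub>R sqrt_derivative (A + 0 *\<^sub>R H) (replicate i H))
    + integral {0..1} (\<lambda>t. ((1 - t) ^ (Suc n - 1) / fact (Suc n - 1)) *\<^sub>R sqrt_derivative (A + t *\<^sub>R H) (replicate (Suc n) H))"
    by (rule Taylor_integral[where Df = "\<lambda>i t. sqrt_derivative (A + t *\<^sub>R H) (replicate i H)"])
      (use sqrt_derivative_has_vector_derivative[OF assms] in auto)
  also have "(\<lambda>t. ((1 - t) ^ (Suc n - 1) / fact (Suc n - 1)) *\<^sub>R sqrt_derivative (A + t *\<^sub>R H) (replicate (Suc n) H))
      = (\<lambda>t. (1 / fact n) *\<^sub>R ((1 - t) ^ n *\<^sub>R sqrt_derivative (A + t *\<^sub>R H) (replicate (Suc n) H)))"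
    by (simp add: fun_eq_iff)
  also have "(\<Sum>i<Suc n. ((1 - 0) ^ i / fact i) *\<^sub>R sqrt_derivative (A + 0 *\<^sub>R H) (replicate i H)) =
      principal_sqrt A + (\<Sum>k = 1..n. (1 / fact k) *\<^sub>R sqrt_derivative A (replicate k H))"
    by (subst sum.lessThan_Suc_shift) (simp add: sum.atLeast1_atMost_eq)
  finally show ?thesis by (simp only: integral_cmul scaleR_one)
qed

text \<open>
  By the Taylor formula the remainder is a difference of symmetric matrices.
\<close>

lemma taylor_integral_symmetric:
  assumes "A \<in> posdef_matrices" "H \<in> symmetric_matrices" "A + H \<in> posdef_matrices"
  shows "(1 / fact n) *\<^sub>R integral {0..1} (\<lambda>t. (1 - t) ^ n *\<^sub>R sqrt_derivative (A + t *\<^sub>R H) (replicate (Suc n) H))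
    \<in> symmetric_matrices" (is "?X \<in> _")
proof -
  have "?X = principal_sqrt (A + H) - (principal_sqrt A
      + (\<Sum>k = 1..n. (1 / fact k) *\<^sub>R sqrt_derivative A (replicate k H)))"
    using principal_sqrt_Taylor[OF assms, of n] by (simp only: add_diff_cancel_left')
  also have "\<dots> \<in> symmetric_matrices"
    using assms principal_sqrt_posdef posdef_symmetric
    by (intro subspace_diff subspace_add subspace_sum subspace_scale subspace_symmetric_matrices
        sqrt_derivative_symmetric) (auto simp: set_replicate_conv_if)
  finally show ?thesis .
qed

lemma has_integral_inverse_sqrt: "((\<lambda>t. 1 / sqrt (1 - t)) has_integral 2) {0..1 :: real}"
proof -
  have "((\<lambda>t. 1 / sqrt (1 - t)) has_integral (- 2 * sqrt (1 - 1) - (- 2 * sqrt (1 - 0)))) {0..1 :: real}"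
  proof (rule fundamental_theorem_of_calculus_interior)
    fix t :: real assume "t \<in> {0<..<1}"
    then have "((\<lambda>t. - 2 * sqrt (1 - t)) has_real_derivative 1 / sqrt (1 - t)) (at t)"
      by (auto intro!: derivative_eq_intros simp: divide_simps)
    then show "((\<lambda>t. - 2 * sqrt (1 - t)) has_vector_derivative 1 / sqrt (1 - t)) (at t)"
      by (simp add: has_real_derivative_iff_has_vector_derivative)
  qed (auto intro!: continuous_intros)
  then show ?thesis by simp
qed

section \<open>Bounds in a submultiplicative norm\<close>

lemma half_sqrt_power_eq_powr:
  assumes "m > 0"
  shows "(1 / (2 * sqrt m)) ^ (2 * n + 1) = 2 powr (- (2 * real n + 1)) * m powr (- (real n + 1 / 2))"
proof -
  have "2 * sqrt m = 2 powr 1 * m powr (1/2)" using assms by (simp add: powr_half_sqrt)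
  then have "1 / (2 * sqrt m) = 2 powr (- 1) * m powr (- (1/2))"
    using assms by (simp add: powr_minus field_simps)
  then have "(1 / (2 * sqrt m)) ^ (2 * n + 1) = (2 powr (- 1)) ^ (2 * n + 1) * (m powr (- (1/2))) ^ (2 * n + 1)"
    by (simp only: power_mult_distrib)
  also have "\<dots> = 2 powr (- 1 * real (2 * n + 1)) * m powr (- (1/2) * real (2 * n + 1))"
  proof -
    have "(b powr a) ^ k = b powr (a * real k)" if "b > 0" for a b :: real and k
      using that by (simp add: powr_power mult.commute)
    then show ?thesis using assms by (simp only: zero_less_numeral)
  qed
  also have "- (1/2) * real (2 * n + 1) = - (real n + 1 / 2)" by (simp add: algebra_simps)
  also have "- 1 * real (2 * n + 1) = - (2 * real n + 1)" by simp
  finally show ?thesis .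
qed

text \<open>
  \<open>M\<close> extends \<open>N\<close> to all matrices, since products of symmetric matrices are not symmetric. The last
  assumption provides for each \<open>X\<close> a functional of norm at most one that is large not just on \<open>X\<close> but on
  \<open>R ** X + X ** R\<close>; it carries the estimate for the Sylvester equation over to the norm \<open>M\<close>.
\<close>

locale submultiplicative_norm = symmetric_norm N c C
  for N :: "real^'r^'r \<Rightarrow> real" and c C :: real +
  fixes M :: "real^'r^'r \<Rightarrow> real"
  assumes M_eq: "\<And>X. X \<in> symmetric_matrices \<Longrightarrow> N X = M X"
    and M_triangle: "\<And>X Y. M (X + Y) \<le> M X + M Y"
    and M_scaleR: "\<And>a X. M (a *\<^sub>R X) = \<bar>a\<bar> * M X"
    and M_mult: "\<And>X Y. M (X ** Y) \<le> M X * M Y"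
    and norming: "\<And>X. X \<in> symmetric_matrices \<Longrightarrow> \<exists>l. linear l \<and> (\<forall>Y. l Y \<le> M Y) \<and>
      (\<forall>R m. coercive m R \<longrightarrow> 2 * m * M X \<le> l (R ** X + X ** R))"
begin

lemma M_nonneg: "0 \<le> M X"
proof -
  have "M 0 = 0" using M_scaleR[of 0 0] by simp
  moreover have "M (- X) = M X" using M_scaleR[of "- 1" X] by simp
  ultimately show ?thesis using M_triangle[of X "- X"] by simp
qed

lemma M_sum: "M (sum f I) \<le> (\<Sum>i\<in>I. M (f i))"
proof (induction I rule: infinite_finite_induct)
  case (insert x F)
  then show ?case using M_triangle[of "f x" "sum f F"] by simp
qed (use M_scaleR[of 0 0] in simp_all)

lemma M_sylvester_le:
  assumes "R \<in> posdef_matrices" "coercive m R" "m > 0" "Y \<in> symmetric_matrices"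
  shows "M (sylvester R Y) \<le> M Y / (2 * m)"
proof -
  obtain l where l: "\<And>Y. l Y \<le> M Y" "2 * m * M (sylvester R Y) \<le> l (R ** sylvester R Y + sylvester R Y ** R)"
    using norming[OF sylvester_symmetric[OF assms(1,4)]] assms(2) by metis
  from this(2) have "2 * m * M (sylvester R Y) \<le> l Y"
    by (simp only: sylvester_solves[OF assms(1)])
  also have "l Y \<le> M Y" by (rule l(1))
  finally have "2 * m * M (sylvester R Y) \<le> M Y" .
  then show ?thesis using assms(3) by (simp add: field_simps)
qed

text \<open>
  For \<open>R\<close> half the identity, \<open>R ** X + X ** R\<close> is \<open>X\<close> itself, so the functional attains the norm of \<open>X\<close>.
  It serves to bound integrals.
\<close>

lemma supporting_functional:
  assumes "X \<in> symmetric_matrices"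
  obtains l :: "real^'r^'r \<Rightarrow> real" where "linear l" "\<And>Y. l Y \<le> M Y" "M X \<le> l X"
proof -
  obtain l where l: "linear l" "\<And>Y. l Y \<le> M Y"
    "\<And>R m. coercive m R \<Longrightarrow> 2 * m * M X \<le> l (R ** X + X ** R)"
    using norming[OF assms] by metis
  have "coercive (1/2) ((1/2) *\<^sub>R mat 1 :: real^'r^'r)"
    by (simp add: coercive_def matvec.scaleR_left)
  from l(3)[OF this] have "M X \<le> l X"
    by (simp add: matmul.scaleR_left matmul.scaleR_right scaleR_add_left[symmetric])
  with l that show ?thesis by blast
qed

text \<open>
  After division by the factorials the recursion is the Catalan recurrence: with \<open>k = 1 / (2 * sqrt m)\<close>,
  the factors of a product contribute \<open>2 * p + 1\<close> and \<open>2 * q + 1\<close> powers of \<open>k\<close>, and solving the Sylvester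
  equation contributes one more.
\<close>

lemma M_sqrt_derivative_le:
  assumes A: "A \<in> posdef_matrices" "m > 0" "coercive m A" and H: "H \<in> symmetric_matrices"
  shows "M (sqrt_derivative A (replicate (Suc n) H)) \<le>
    fact (Suc n) * catalan n * (1 / (2 * sqrt m)) ^ (2 * n + 1) * M H ^ Suc n"
proof (induction n rule: less_induct)
  case (less n)
  let ?G = "sqrt_derivative A" and ?k = "1 / (2 * sqrt m)"
  have co: "coercive (sqrt m) (principal_sqrt A)" and R: "principal_sqrt A \<in> posdef_matrices"
    using coercive_principal_sqrt[OF A(1) A(2,3)] principal_sqrt_posdef[OF A(1)] by auto
  have solve: "M (sylvester (principal_sqrt A) Y) \<le> ?k * M Y" if "Y \<in> symmetric_matrices" for Y
    using M_sylvester_le[OF R co _ that] A(2) by (simp add: field_simps)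
  show ?case
  proof (cases n)
    case 0
    then show ?thesis using solve[OF H] by (simp add: sqrt_derivative_singleton catalan_0)
  next
    case (Suc n')
    let ?N = "Suc (Suc n')" and ?Y = "leibniz ?G ?G (replicate (Suc (Suc n')) H)"
    have Y: "?Y \<in> symmetric_matrices"
      using H by (intro leibniz_sqrt_derivative_symmetric A) (simp add: set_replicate_conv_if)
    have MY: "M ?Y \<le> fact ?N * (catalan (Suc n') * ?k ^ (2 * n' + 2) * M H ^ ?N)"
    proof -
      have set_eq: "{(p, q). p + q = ?N - 2} = (\<lambda>p. (p, n' - p)) ` {..n'}" by auto
      have "?Y = (\<Sum>p\<le>n'. (fact ?N / (fact (Suc p) * fact (Suc (n' - p)))) *\<^sub>R
          (?G (replicate (Suc p) H) ** ?G (replicate (Suc (n' - p)) H)))"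
        by (subst leibniz_replicate_factorial) (simp_all only: set_eq, simp_all add: sum.reindex inj_on_def)
      then have "M ?Y \<le> (\<Sum>p\<le>n'. M ((fact ?N / (fact (Suc p) * fact (Suc (n' - p)))) *\<^sub>R
          (?G (replicate (Suc p) H) ** ?G (replicate (Suc (n' - p)) H))))"
        by (simp only: M_sum)
      also have "\<dots> \<le> (\<Sum>p\<le>n'. fact ?N * ?k ^ (2 * n' + 2) * M H ^ ?N * (catalan p * catalan (n' - p)))"
      proof (rule sum_mono)
        fix p assume "p \<in> {..n'}"
        then obtain q where q: "n' = p + q" using le_Suc_ex by auto
        let ?c = "fact ?N / (fact (Suc p) * fact (Suc q)) :: real"
        have "M (?c *\<^sub>R (?G (replicate (Suc p) H) ** ?G (replicate (Suc q) H)))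
            = ?c * M (?G (replicate (Suc p) H) ** ?G (replicate (Suc q) H))"
          by (simp only: M_scaleR) simp
        also have "\<dots> \<le> ?c * (M (?G (replicate (Suc p) H)) * M (?G (replicate (Suc q) H)))"
          by (intro mult_left_mono M_mult) simp
        also have "\<dots> \<le> ?c * ((fact (Suc p) * catalan p * ?k ^ (2 * p + 1) * M H ^ Suc p) *
            (fact (Suc q) * catalan q * ?k ^ (2 * q + 1) * M H ^ Suc q))"
          using A(2) q Suc
          by (intro mult_left_mono mult_mono less.IH mult_nonneg_nonneg M_nonneg zero_le_power catalan_nonneg) auto
        also have "\<dots> = (fact ?N / (fact (Suc p) * fact (Suc q)) * (fact (Suc p) * fact (Suc q))) *
            (?k ^ (2 * p + 1) * ?k ^ (2 * q + 1)) * (M H ^ Suc p * M H ^ Suc q) * (catalan p * catalan q)"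
          by (simp only: mult_ac)
        also have "fact ?N / (fact (Suc p) * fact (Suc q)) * (fact (Suc p) * fact (Suc q)) = (fact ?N :: real)"
          by (simp del: fact_Suc)
        also have "?k ^ (2 * p + 1) * ?k ^ (2 * q + 1) = ?k ^ (2 * n' + 2)"
          unfolding power_add[symmetric] q by (rule arg_cong) simp
        also have "M H ^ Suc p * M H ^ Suc q = M H ^ ?N"
          unfolding power_add[symmetric] q by (rule arg_cong) simp
        finally show "M ((fact ?N / (fact (Suc p) * fact (Suc (n' - p)))) *\<^sub>R
            (?G (replicate (Suc p) H) ** ?G (replicate (Suc (n' - p)) H)))
            \<le> fact ?N * ?k ^ (2 * n' + 2) * M H ^ ?N * (catalan p * catalan (n' - p))"
          by (simp only: q add_diff_cancel_left')
      qed
      also have "\<dots> = fact ?N * (catalan (Suc n') * ?k ^ (2 * n' + 2) * M H ^ ?N)"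
        unfolding catalan_convolution sum_distrib_left[symmetric] by (simp only: mult_ac)
      finally show ?thesis .
    qed
    have "M (- ?Y) = M ?Y" using M_scaleR[of "- 1" ?Y] by simp
    moreover have "- ?Y \<in> symmetric_matrices" by (rule subspace_neg[OF subspace_symmetric_matrices Y])
    ultimately have "M (?G (replicate (Suc n) H)) \<le> ?k * M ?Y"
      using solve[of "- ?Y"] sqrt_derivative_replicate[of ?N A H] Suc by (simp del: replicate_Suc)
    also have "\<dots> \<le> ?k * (fact ?N * (catalan (Suc n') * ?k ^ (2 * n' + 2) * M H ^ ?N))"
      using A(2) by (intro mult_left_mono MY) simp
    also have "\<dots> = fact (Suc n) * catalan n * ?k ^ (2 * n + 1) * M H ^ Suc n"
      by (simp add: Suc mult_ac)
    finally show ?thesis .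
  qed
qed

text \<open>
  At the parameter \<open>t\<close> the lower bound is \<open>(1 - t) * lambda_min A\<close>, whose power \<open>- (n + 1/2)\<close> leaves
  \<open>1 / sqrt (1 - t)\<close> after multiplication with the Taylor weight \<open>(1 - t) ^ n\<close>. This is integrable with
  integral \<open>2\<close>.
\<close>

lemma M_taylor_remainder_le:
  assumes A: "A \<in> posdef_matrices" and H: "H \<in> symmetric_matrices" and AH: "A + H \<in> posdef_matrices"
  shows "M ((1 / fact n) *\<^sub>R integral {0..1} (\<lambda>t. (1 - t) ^ n *\<^sub>R sqrt_derivative (A + t *\<^sub>R H) (replicate (Suc n) H)))
    \<le> 2 * ((real n + 1) * catalan n * (1 / (2 * sqrt (lambda_min A))) ^ (2 * n + 1) * M H ^ Suc n)"
proof -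
  let ?f = "\<lambda>t. (1 - t) ^ n *\<^sub>R sqrt_derivative (A + t *\<^sub>R H) (replicate (Suc n) H)"
  let ?b = "fact (Suc n) * catalan n * (1 / (2 * sqrt (lambda_min A))) ^ (2 * n + 1) * M H ^ Suc n"
  let ?X = "(1 / fact n) *\<^sub>R integral {0..1} ?f"
  have m: "lambda_min A > 0" by (rule lambda_min_pos[OF A])
  obtain l :: "real^'r^'r \<Rightarrow> real" where l: "linear l" "\<And>Y. l Y \<le> M Y" "M ?X \<le> l ?X"
    by (rule supporting_functional[OF taylor_integral_symmetric[OF assms, of n]]) blast
  have "?f integrable_on {0..1}"
    by (intro integrable_continuous_real continuous_intros continuous_on_sqrt_derivative_segment assms)
  then have "((\<lambda>t. l (?f t)) has_integral l (integral {0..1} ?f)) {0..1}"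
    using has_integral_linear[OF integrable_integral, of ?f "{0..1}" l] l(1)
    by (simp add: o_def linear_linear)
  \<comment> \<open>at \<open>t = 1\<close> the bound below is zero, as \<open>1 / sqrt 0 = 0\<close>, which the integrand need not satisfy\<close>
  then have "((\<lambda>t. if t = 1 then 0 else l (?f t)) has_integral l (integral {0..1} ?f)) {0..1}"
    by (rule has_integral_spike_finite[of "{1}", rotated 2]) auto
  moreover have "((\<lambda>t. ?b * (1 / sqrt (1 - t))) has_integral ?b * 2) {0..1}"
    by (rule has_integral_mult_right[OF has_integral_inverse_sqrt])
  ultimately have "l (integral {0..1} ?f) \<le> ?b * 2"
  proof (rule has_integral_le)
    fix t :: real assume t: "t \<in> {0..1}"
    show "(if t = 1 then 0 else l (?f t)) \<le> ?b * (1 / sqrt (1 - t))"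
    proof (cases "t = 1")
      case False
      then have s: "1 - t > 0" using t by simp
      let ?Z = "sqrt_derivative (A + t *\<^sub>R H) (replicate (Suc n) H)"
      have "l (?f t) \<le> (1 - t) ^ n * M ?Z"
        using l(2)[of "?f t"] s by (simp only: M_scaleR) simp
      also have "M ?Z \<le> fact (Suc n) * catalan n * (1 / (2 * sqrt ((1 - t) * lambda_min A))) ^ (2 * n + 1) * M H ^ Suc n"
        using m s by (intro M_sqrt_derivative_le posdef_on_segment coercive_segment assms t) simp
      also have "(1 - t) ^ n * (fact (Suc n) * catalan n * (1 / (2 * sqrt ((1 - t) * lambda_min A))) ^ (2 * n + 1) * M H ^ Suc n)
          = ?b * ((1 - t) ^ n * (1 / sqrt (1 - t)) ^ (2 * n + 1))"
        by (simp add: real_sqrt_mult power_divide power_mult_distrib mult_ac del: fact_Suc power_Suc)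
      also have "(1 - t) ^ n * (1 / sqrt (1 - t)) ^ (2 * n + 1) = 1 / sqrt (1 - t)"
        using s by (simp add: power_divide power_mult)
      finally show ?thesis using False s by (simp add: mult_left_mono)
    qed simp
  qed
  then have "l ?X \<le> (1 / fact n) * (?b * 2)"
    unfolding linear_scale[OF l(1)] real_scaleR_def by (intro mult_left_mono) simp_all
  also have "\<dots> = 2 * ((real n + 1) * catalan n * (1 / (2 * sqrt (lambda_min A))) ^ (2 * n + 1) * M H ^ Suc n)"
  proof -
    have "1 / f * (((x + 1) * f) * a * b * d * 2) = 2 * ((x + 1) * a * b * d)" if "f > 0" for f x a b d :: real
      using that by simp
    from this[of "fact n" "real n"] show ?thesis by (simp only: fact_Suc of_nat_Suc fact_gt_zero add.commute)
  qed
  finally show ?thesis using l(3) by linarith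
qed

lemma taylor_remainder_principal_sqrt:
  assumes "A \<in> posdef_matrices" "H \<in> symmetric_matrices" "A + H \<in> posdef_matrices"
  shows "taylor_remainder N posdef_matrices principal_sqrt n A H = (1 / fact n) *\<^sub>R
    integral {0..1} (\<lambda>t. (1 - t) ^ n *\<^sub>R sqrt_derivative (A + t *\<^sub>R H) (replicate (Suc n) H))"
  unfolding taylor_remainder_def
  using nabla_dir_principal_sqrt[OF posdef_on_segment[OF assms] assms(2), of _ "n + 1"]
  by (intro arg_cong[of _ _ "\<lambda>X. (1 / fact n) *\<^sub>R X"] integral_cong) simp

lemma nabla_norm_principal_sqrt_le:
  assumes A: "A \<in> posdef_matrices" and K: "K \<ge> 1"
  shows "nabla_norm N posdef_matrices principal_sqrt (n + 1) A \<le>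
    ereal (K ^ n * fact (n + 1) * catalan n * 2 powr (- (2 * real n + 1))
      * lambda_min A powr (- (real n + 1 / 2)))"
  unfolding nabla_norm_def
proof (rule SUP_least)
  fix H assume "H \<in> {H \<in> symmetric_matrices. N H = 1}"
  then have H: "H \<in> symmetric_matrices" "M H = 1" using M_eq by auto
  let ?c = "fact (n + 1) * catalan n * (2 powr (- (2 * real n + 1)) * lambda_min A powr (- (real n + 1 / 2)))"
  have "N (nabla_dir N posdef_matrices principal_sqrt (n + 1) A H) = M (sqrt_derivative A (replicate (Suc n) H))"
    using nabla_dir_principal_sqrt[OF A H(1), of "n + 1"] A H(1)
    by (subst M_eq[symmetric]) (auto intro!: sqrt_derivative_symmetric simp: set_replicate_conv_if split: if_splits)
  also have "\<dots> \<le> ?c"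
    using M_sqrt_derivative_le[OF A lambda_min_pos[OF A] coercive_lambda_min[OF posdef_symmetric[OF A]] H(1), of n]
    by (simp only: half_sqrt_power_eq_powr[OF lambda_min_pos[OF A]] H(2)) simp
  also have "\<dots> \<le> K ^ n * ?c"
  proof -
    have "0 \<le> ?c" by (intro mult_nonneg_nonneg catalan_nonneg) auto
    then show ?thesis using mult_right_mono[OF one_le_power[OF K, of n], of ?c] by simp
  qed
  finally show "ereal (N (nabla_dir N posdef_matrices principal_sqrt (n + 1) A H)) \<le>
      ereal (K ^ n * fact (n + 1) * catalan n * 2 powr (- (2 * real n + 1))
      * lambda_min A powr (- (real n + 1 / 2)))"
    by (simp only: mult.assoc ereal_less_eq)
qed

lemma taylor_remainder_principal_sqrt_le:
  assumes A: "A \<in> posdef_matrices" and H: "H \<in> symmetric_matrices" and AH: "A + H \<in> posdef_matrices"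
    and K: "K \<ge> 1"
  shows "N (taylor_remainder N posdef_matrices principal_sqrt n A H) \<le>
    K ^ n * (real n + 1) * catalan n * 2 powr (- (2 * real n))
      * lambda_min A powr (- (real n + 1 / 2)) * N H ^ (n + 1)"
proof -
  let ?c = "(real n + 1) * (catalan n * (2 powr (- (2 * real n)) * (lambda_min A powr (- (real n + 1 / 2)) * M H ^ (n + 1))))"
  let ?X = "taylor_remainder N posdef_matrices principal_sqrt n A H"
  have "N ?X = M ?X"
    unfolding taylor_remainder_principal_sqrt[OF A H AH]
    by (rule M_eq[OF taylor_integral_symmetric[OF A H AH]])
  also have "\<dots> \<le> 2 * ((real n + 1) * catalan n * (1 / (2 * sqrt (lambda_min A))) ^ (2 * n + 1) * M H ^ Suc n)"
    unfolding taylor_remainder_principal_sqrt[OF A H AH] by (rule M_taylor_remainder_le[OF A H AH])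
  also have "\<dots> = (real n + 1) * (catalan n * ((2 * 2 powr (- (2 * real n + 1))) *
      (lambda_min A powr (- (real n + 1 / 2)) * M H ^ (n + 1))))"
    unfolding half_sqrt_power_eq_powr[OF lambda_min_pos[OF A]] by (simp add: mult_ac)
  also have "2 * 2 powr (- (2 * real n + 1)) = (2 powr (- (2 * real n)) :: real)"
    by (simp add: powr_diff)
  also have "?c \<le> K ^ n * ?c"
  proof -
    have "0 \<le> ?c" by (intro mult_nonneg_nonneg catalan_nonneg zero_le_power M_nonneg) auto
    then show ?thesis using mult_right_mono[OF one_le_power[OF K, of n], of ?c] by simp
  qed
  finally show ?thesis by (simp only: mult.assoc M_eq[OF H])
qed

end

section \<open>The Frobenius norm and the spectral norm\<close>

lemma frobenius_norm_eq_norm: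
  assumes "A \<in> symmetric_matrices"
  shows "frobenius_norm A = norm A"
proof -
  have "A $ i $ j = A $ j $ i" for i j
    using assms by (metis (mono_tags) mem_Collect_eq symmetric_matrices_def transpose_def vec_lambda_beta)
  then have "trace (A ** A) = A \<bullet> A"
    by (simp add: trace_def matrix_matrix_mult_def inner_vec_def)
  then show ?thesis by (simp add: frobenius_norm_def norm_eq_sqrt_inner)
qed

text \<open>
  The functional is the inner product with \<open>X / norm X\<close>.
\<close>

lemma submultiplicative_norm_frobenius:
  "submultiplicative_norm (frobenius_norm :: real^'r^'r \<Rightarrow> real) 1 1 norm"
proof
  fix X :: "real^'r^'r"
  show "\<exists>l. linear l \<and> (\<forall>Y. l Y \<le> norm Y) \<and>
      (\<forall>R m. coercive m R \<longrightarrow> 2 * m * norm X \<le> l (R ** X + X ** R))"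
  proof (cases "X = 0")
    case True
    then show ?thesis by (intro exI[of _ "\<lambda>_. 0"]) (simp add: linear_zero)
  next
    case False
    have "linear (\<lambda>Y. X \<bullet> Y / norm X)"
      by (intro linearI) (simp_all add: inner_add_right add_divide_distrib)
    moreover have "X \<bullet> Y / norm X \<le> norm Y" for Y
      using False norm_cauchy_schwarz[of X Y] by (simp add: pos_divide_le_eq mult.commute)
    moreover have "2 * m * norm X \<le> X \<bullet> (R ** X + X ** R) / norm X" if "coercive m R" for R m
    proof -
      have "2 * m * norm X * norm X \<le> X \<bullet> (R ** X + X ** R)"
        using sylvester_inner_lower_bound[OF that that, of X]
        by (simp add: power2_norm_eq_inner[symmetric] power2_eq_square mult_ac)
      then show ?thesis using False by (simp add: pos_le_divide_eq)
    qed
    ultimately show ?thesis by (intro exI[of _ "\<lambda>Y. X \<bullet> Y / norm X"]) simp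
  qed
qed (auto simp: frobenius_norm_eq_norm norm_triangle_ineq norm_matrix_mult_le)

lemma lambda_max:
  fixes B :: "real^'r^'r"
  assumes "B \<in> symmetric_matrices"
  obtains v where "norm v = 1" "B *v v = lambda_max B *\<^sub>R v"
    "\<And>x. x \<bullet> (B *v x) \<le> lambda_max B * (x \<bullet> x)"
proof -
  have "(UNIV :: (real^'r) set) \<noteq> {0}"
    by (metis UNIV_I axis_eq_0_iff singletonD zero_neq_one)
  moreover have "- B \<in> symmetric_matrices"
    using subspace_neg[OF subspace_symmetric_matrices assms] .
  ultimately obtain v l where v: "norm v = 1" "(- B) *v v = l *\<^sub>R v"
    and low: "\<And>x. l * (x \<bullet> x) \<le> x \<bullet> ((- B) *v x)"
    using rayleigh_minimum[of "- B" UNIV] by auto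
  have eig: "B *v v = (- l) *\<^sub>R v" using v(2) by (simp add: matvec.minus_left) (metis minus_minus)
  have up: "x \<bullet> (B *v x) \<le> - l * (x \<bullet> x)" for x
    using low[of x] by (simp add: matvec.minus_left)
  have mem: "- l \<in> eigenvalues B"
    using v eig by (auto simp: eigenvalues_def intro!: exI[of _ v])
  have "k \<le> - l" if "k \<in> eigenvalues B" for k
  proof -
    obtain w where w: "w \<noteq> 0" "B *v w = k *\<^sub>R w"
      using \<open>k \<in> eigenvalues B\<close> by (auto simp: eigenvalues_def)
    have "k * (w \<bullet> w) \<le> - l * (w \<bullet> w)" using up[of w] w(2) by simp
    then show ?thesis using w(1) by (intro mult_right_le_imp_le[of k "w \<bullet> w" "- l"]) simp_all
  qed
  then have "lambda_max B = - l"
    unfolding lambda_max_def using mem finite_eigenvalues[OF assms] by (intro Max_eqI) auto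
  with v(1) eig up show ?thesis using that[of v] by simp
qed

text \<open>
  A maximiser \<open>v\<close> of \<open>norm (X *v v)\<close> on the unit sphere satisfies \<open>(X - s) (X + s) v = 0\<close> with
  \<open>s\<close> the operator norm. So either \<open>v\<close> or \<open>(X + s) v\<close> is an eigenvector of \<open>X\<close>, for \<open>- s\<close> or \<open>s\<close>.
\<close>

lemma spectral_norm_attained:
  fixes X :: "real^'r^'r"
  assumes X: "X \<in> symmetric_matrices"
  shows "spectral_norm X = onorm ((*v) X)"
    and "\<exists>v s. norm v = 1 \<and> X *v v = s *\<^sub>R v \<and> \<bar>s\<bar> = onorm ((*v) X)"
proof -
  have XX: "X ** X \<in> symmetric_matrices"
    using X by (simp add: symmetric_matrices_def matrix_transpose_mul)
  define q where "q = lambda_max (X ** X)"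
  obtain v where v: "norm v = 1" "(X ** X) *v v = q *\<^sub>R v"
    and up: "\<And>x. x \<bullet> ((X ** X) *v x) \<le> q * (x \<bullet> x)"
    using lambda_max[OF XX] unfolding q_def by metis
  have sq: "x \<bullet> ((X ** X) *v x) = (norm (X *v x))\<^sup>2" for x
    by (simp add: matrix_vector_mul_assoc[symmetric] symmetric_inner[OF X] power2_norm_eq_inner)
  have q: "q = (norm (X *v v))\<^sup>2"
    using sq[of v] v by (simp add: norm_eq_1)
  define s where "s = sqrt q"
  have s: "s \<ge> 0" "s\<^sup>2 = q" by (simp_all add: s_def q)
  have "onorm ((*v) X) = s"
  proof (rule antisym)
    show "onorm ((*v) X) \<le> s"
    proof (rule onorm_le)
      fix x
      have "(norm (X *v x))\<^sup>2 \<le> (s * norm x)\<^sup>2"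
        using up[of x] by (simp add: sq power_mult_distrib s(2) power2_norm_eq_inner)
      then show "norm (X *v x) \<le> s * norm x"
        using s(1) by (simp add: power2_le_iff_abs_le)
    qed
    have "s = norm (X *v v)" by (simp add: s_def q)
    then show "s \<le> onorm ((*v) X)"
      using onorm[OF matrix_vector_mul_bounded_linear, of X v] v(1) by simp
  qed
  then show "spectral_norm X = onorm ((*v) X)"
    by (simp add: spectral_norm_def s_def q_def)
  define w where "w = X *v v + s *\<^sub>R v"
  show "\<exists>v s. norm v = 1 \<and> X *v v = s *\<^sub>R v \<and> \<bar>s\<bar> = onorm ((*v) X)"
  proof (cases "w = 0")
    case True
    then have "X *v v = (- s) *\<^sub>R v" by (simp add: w_def eq_neg_iff_add_eq_0)
    then show ?thesis using v(1) s(1) \<open>onorm ((*v) X) = s\<close> by (intro exI[of _ v] exI[of _ "- s"]) simp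
  next
    case False
    have "X *v w = s *\<^sub>R w"
      using v(2) s(2)[symmetric]
      by (simp add: w_def matvec.add_right matvec.scaleR_right matrix_vector_mul_assoc
          scaleR_add_right power2_eq_square)
    then have "X *v ((1 / norm w) *\<^sub>R w) = s *\<^sub>R ((1 / norm w) *\<^sub>R w)"
      by (simp add: matvec.scaleR_right)
    then show ?thesis using False s(1) \<open>onorm ((*v) X) = s\<close>
      by (intro exI[of _ "(1 / norm w) *\<^sub>R w"] exI[of _ s]) simp
  qed
qed

lemma norm_le_onorm: "norm (X :: real^'r^'r) \<le> (real CARD('r))\<^sup>2 * onorm ((*v) X)"
proof -
  have "norm X \<le> (\<Sum>i\<in>UNIV. norm (X $ i))"
    unfolding norm_vec_def[of X] by (rule L2_set_le_sum) simp
  also have "\<dots> \<le> (\<Sum>i\<in>UNIV. \<Sum>j\<in>UNIV. \<bar>X $ i $ j\<bar>)"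
    by (intro sum_mono norm_le_l1_cart)
  also have "\<dots> \<le> (\<Sum>i\<in>(UNIV :: 'r set). \<Sum>j\<in>(UNIV :: 'r set). onorm ((*v) X))"
    by (intro sum_mono matrix_component_le_onorm)
  finally show ?thesis by (simp add: power2_eq_square mult_ac)
qed

text \<open>
  The functional is \<open>Y \<mapsto> v \<bullet> (Y *v v)\<close> up to sign, where \<open>v\<close> is a unit eigenvector of \<open>X\<close> whose
  eigenvalue has maximal modulus: on it, \<open>R ** X + X ** R\<close> acts like \<open>2 * s\<close> times the form of \<open>R\<close>.
\<close>

lemma submultiplicative_norm_spectral:
  "submultiplicative_norm (spectral_norm :: real^'r^'r \<Rightarrow> real) (1 / (real CARD('r))\<^sup>2) 1 (\<lambda>X. onorm ((*v) X))"
proof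
  have bl: "bounded_linear ((*v) X)" for X :: "real^'r^'r" by (rule matrix_vector_mul_bounded_linear)
  show "0 < 1 / (real CARD('r))\<^sup>2" by simp
  show "(0 :: real) < 1" by simp
  fix X Y :: "real^'r^'r" and a :: real
  show "1 / (real CARD('r))\<^sup>2 * norm X \<le> spectral_norm X" if "X \<in> symmetric_matrices"
    using norm_le_onorm[of X] by (simp add: spectral_norm_attained(1)[OF that] pos_divide_le_eq mult.commute)
  show "spectral_norm X \<le> 1 * norm X" if "X \<in> symmetric_matrices"
    using norm_matrix_vector_mult_le[of X] by (simp add: spectral_norm_attained(1)[OF that] onorm_le)
  show "spectral_norm X = onorm ((*v) X)" if "X \<in> symmetric_matrices"
    by (rule spectral_norm_attained(1)[OF that])
  show "onorm ((*v) (X + Y)) \<le> onorm ((*v) X) + onorm ((*v) Y)"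
    using onorm_triangle[OF bl bl, of X Y] by (simp add: matvec.add_left[abs_def] fun_eq_iff)
  show "onorm ((*v) (a *\<^sub>R X)) = \<bar>a\<bar> * onorm ((*v) X)"
    using onorm_scaleR[OF bl, of a X] by (simp add: matvec.scaleR_left[abs_def])
  show "onorm ((*v) (X ** Y)) \<le> onorm ((*v) X) * onorm ((*v) Y)"
    using onorm_compose[OF bl bl, of X Y] by (simp add: o_def matrix_vector_mul_assoc)
  assume X: "X \<in> symmetric_matrices"
  obtain v s where v: "norm v = 1" "X *v v = s *\<^sub>R v" "\<bar>s\<bar> = onorm ((*v) X)"
    using spectral_norm_attained(2)[OF X] by blast
  define l where "l Y = sgn s * (v \<bullet> (Y *v v))" for Y :: "real^'r^'r"
  have "linear l"
    by (intro linearI) (simp_all add: l_def matvec.add_left matvec.scaleR_left inner_add_right algebra_simps)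
  moreover have "l Y \<le> onorm ((*v) Y)" for Y
  proof -
    have "l Y \<le> \<bar>v \<bullet> (Y *v v)\<bar>" by (cases "s > 0"; cases "s = 0") (simp_all add: l_def sgn_if abs_ge_self abs_ge_minus_self)
    also have "\<dots> \<le> norm (Y *v v)" using Cauchy_Schwarz_ineq2[of v "Y *v v"] v(1) by simp
    also have "\<dots> \<le> onorm ((*v) Y)" using onorm[OF bl, of Y v] v(1) by simp
    finally show ?thesis .
  qed
  moreover have "2 * m * onorm ((*v) X) \<le> l (R ** X + X ** R)" if "coercive m R" for R m
  proof -
    have "v \<bullet> ((R ** X + X ** R) *v v) = 2 * s * (v \<bullet> (R *v v))"
      by (simp add: matvec.add_left matrix_vector_mul_assoc[symmetric] inner_add_right v(2)
          matvec.scaleR_right symmetric_inner[OF X])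
    then have "l (R ** X + X ** R) = 2 * \<bar>s\<bar> * (v \<bullet> (R *v v))"
      by (simp add: l_def sgn_if)
    moreover have "m \<le> v \<bullet> (R *v v)"
      using that v(1) by (metis coercive_def mult.right_neutral norm_eq_1)
    then have "2 * \<bar>s\<bar> * m \<le> 2 * \<bar>s\<bar> * (v \<bullet> (R *v v))" by (intro mult_left_mono) auto
    ultimately show ?thesis using v(3) by (simp add: mult_ac)
  qed
  ultimately show "\<exists>l. linear l \<and> (\<forall>Y. l Y \<le> onorm ((*v) Y)) \<and>
      (\<forall>R m. coercive m R \<longrightarrow> 2 * m * onorm ((*v) X) \<le> l (R ** X + X ** R))"
    by blast
qed

section \<open>The theorem\<close>

theorem theorem1p1:
  fixes N :: "real^'r^'r \<Rightarrow> real" and K :: real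
    and \<phi> :: "real^'r^'r \<Rightarrow> real^'r^'r"
    and D :: "nat \<Rightarrow> real^'r^'r \<Rightarrow> real^'r^'r \<Rightarrow> real^'r^'r"
  assumes norm: "N = frobenius_norm \<and> K = sqrt (real CARD('r)) \<or> N = spectral_norm \<and> K = 1"
    and phi: "\<phi> = principal_sqrt"
    and D: "D = nabla_dir N posdef_matrices \<phi>"
  shows "(\<phi> \<in> posdef_matrices \<rightarrow> posdef_matrices)
    \<and> (frechet_differentiable_any_order_on N posdef_matrices \<phi>)
    \<and> (\<forall>A \<in> posdef_matrices. \<forall>H \<in> symmetric_matrices.
           (\<lambda>t. matrix_exp (- t *\<^sub>R \<phi> A) ** H ** matrix_exp (- t *\<^sub>R \<phi> A))
             absolutely_integrable_on {0..} \<and>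
           D 1 A H =
             integral {0..} (\<lambda>t. matrix_exp (- t *\<^sub>R \<phi> A) ** H ** matrix_exp (- t *\<^sub>R \<phi> A)))
    \<and> (\<forall>A \<in> posdef_matrices. \<forall>H \<in> symmetric_matrices. \<forall>n \<ge> 2.
           D n A H =
             - D 1 A (\<Sum>(p, q) \<in> {(p, q). p + q = n - 2}.
                 (fact n / (fact (p + 1) * fact (q + 1))) *\<^sub>R
                   (D (p + 1) A H ** D (q + 1) A H)))
    \<and> (\<forall>A \<in> posdef_matrices. \<forall>H \<in> symmetric_matrices. A + H \<in> posdef_matrices \<longrightarrow> (\<forall>n.
           (\<lambda>\<epsilon>. (1 - \<epsilon>) ^ n *\<^sub>R D (n + 1) (A + \<epsilon> *\<^sub>R H) H) absolutely_integrable_on {0..1} \<and>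
           \<phi> (A + H) =
             \<phi> A + (\<Sum>k = 1..n. (1 / fact k) *\<^sub>R D k A H)
               + taylor_remainder N posdef_matrices \<phi> n A H))
    \<and> (\<forall>A \<in> posdef_matrices. \<forall>n.
           nabla_norm N posdef_matrices \<phi> (n + 1) A \<le>
             ereal (K ^ n * fact (n + 1) * catalan n * 2 powr (- (2 * real n + 1))
                      * lambda_min A powr (- (real n + 1 / 2))))
    \<and> (\<forall>A \<in> posdef_matrices. \<forall>H \<in> symmetric_matrices. A + H \<in> posdef_matrices \<longrightarrow> (\<forall>n.
           N (taylor_remainder N posdef_matrices \<phi> n A H) \<le>
             K ^ n * (real n + 1) * catalan n * 2 powr (- (2 * real n))
               * lambda_min A powr (- (real n + 1 / 2)) * N H ^ (n + 1)))"
proof -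
  have K: "K \<ge> 1" using norm by auto
  obtain c C M where "submultiplicative_norm N c C M"
    using norm submultiplicative_norm_frobenius submultiplicative_norm_spectral by blast
  then interpret submultiplicative_norm N c C M .
  have D_eq: "D n A H = sqrt_derivative A (replicate n H)"
    if "A \<in> posdef_matrices" "H \<in> symmetric_matrices" for n A H
    using that by (simp add: D phi nabla_dir_principal_sqrt)
  have D1: "D 1 A H = sylvester (principal_sqrt A) H"
    if "A \<in> posdef_matrices" "H \<in> symmetric_matrices" for A H
    using that by (simp add: D_eq sqrt_derivative_singleton)
  have first: "(\<lambda>t. matrix_exp (- t *\<^sub>R \<phi> A) ** H ** matrix_exp (- t *\<^sub>R \<phi> A)) absolutely_integrable_on {0..} \<and>
      D 1 A H = integral {0..} (\<lambda>t. matrix_exp (- t *\<^sub>R \<phi> A) ** H ** matrix_exp (- t *\<^sub>R \<phi> A))"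
    if "A \<in> posdef_matrices" "H \<in> symmetric_matrices" for A H
    using sylvester_absolutely_integrable[OF principal_sqrt_posdef[OF that(1)], of H]
      integral_unique[OF sylvester_has_integral[OF principal_sqrt_posdef[OF that(1)], of H]]
    unfolding D1[OF that] phi by metis
  have higher: "D n A H = - D 1 A (\<Sum>(p, q) \<in> {(p, q). p + q = n - 2}.
      (fact n / (fact (p + 1) * fact (q + 1))) *\<^sub>R (D (p + 1) A H ** D (q + 1) A H))"
    if A: "A \<in> posdef_matrices" and H: "H \<in> symmetric_matrices" and n: "n \<ge> 2" for A H n
  proof -
    let ?Y = "leibniz (sqrt_derivative A) (sqrt_derivative A) (replicate n H)"
    have Y: "?Y \<in> symmetric_matrices"
      using H by (intro leibniz_sqrt_derivative_symmetric A) (simp add: set_replicate_conv_if)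
    have "D n A H = - D 1 A ?Y"
      by (simp only: D_eq[OF A H] D1[OF A Y] sqrt_derivative_replicate[OF n]
          linear_neg[OF linear_sylvester[OF principal_sqrt_posdef[OF A]]])
    then show ?thesis
      by (simp only: leibniz_replicate_factorial[OF n] D_eq[OF A H])
  qed
  have taylor: "(\<lambda>\<epsilon>. (1 - \<epsilon>) ^ n *\<^sub>R D (n + 1) (A + \<epsilon> *\<^sub>R H) H) absolutely_integrable_on {0..1} \<and>
      \<phi> (A + H) = \<phi> A + (\<Sum>k = 1..n. (1 / fact k) *\<^sub>R D k A H) + taylor_remainder N posdef_matrices \<phi> n A H"
    if A: "A \<in> posdef_matrices" and H: "H \<in> symmetric_matrices" and AH: "A + H \<in> posdef_matrices" for A H n
  proof
    have "continuous_on {0..1} (\<lambda>\<epsilon>. (1 - \<epsilon>) ^ n *\<^sub>R sqrt_derivative (A + \<epsilon> *\<^sub>R H) (replicate (n + 1) H))"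
      by (intro continuous_intros continuous_on_sqrt_derivative_segment A H AH)
    then have "continuous_on {0..1} (\<lambda>\<epsilon>. (1 - \<epsilon>) ^ n *\<^sub>R D (n + 1) (A + \<epsilon> *\<^sub>R H) H)"
      by (rule continuous_on_eq) (simp only: D_eq[OF posdef_on_segment[OF A H AH] H])
    then show "(\<lambda>\<epsilon>. (1 - \<epsilon>) ^ n *\<^sub>R D (n + 1) (A + \<epsilon> *\<^sub>R H) H) absolutely_integrable_on {0..1}"
      by (rule absolutely_integrable_continuous_real)
    show "\<phi> (A + H) = \<phi> A + (\<Sum>k = 1..n. (1 / fact k) *\<^sub>R D k A H) + taylor_remainder N posdef_matrices \<phi> n A H"
      unfolding phi D_eq[OF A H] taylor_remainder_principal_sqrt[OF A H AH]
      by (rule principal_sqrt_Taylor[OF A H AH])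
  qed
  show ?thesis
    using principal_sqrt_posdef principal_sqrt_differentiable_any_order first higher taylor
      nabla_norm_principal_sqrt_le[OF _ K] taylor_remainder_principal_sqrt_le[OF _ _ _ K]
    unfolding phi by (intro conjI ballI allI impI) (auto simp del: One_nat_def)
qed

end
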